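(* Let $\mathfrak{g}$ be the insertion-elimination algebra, and let $\mathfrak{g}^+=\mathrm{span}_{\mathbb{C}}\{D_t^+\mid t\in\mathbb{T}\}$ and $\mathfrak{g}^-=\mathrm{span}_{\mathbb{C}}\{D_t^-\mid t\in\mathbb{T}\}$. Then the subalgebras $\mathfrak{g}^+$ and $\mathfrak{g}^-$ are completely self-centralizing.
   Context: A rooted tree is a finite connected undirected cycle-free graph $t$ with a distinguished vertex $\mathrm{rt}(t)$, its root. Rooted trees are considered up to (root-preserving graph) isomorphism; equality of rooted trees means isomorphism, and $\mathbb{T}$ is the set of all isomorphism classes of rooted trees. $V(t)$ and $E(t)$ are the sets of vertices and edges of $t$, and $|t|$ is the cardinality of $V(t)$. For $e\in E(t)$, removing $e$ divides $t$ into two rooted subtrees: $R_e(t)$ is the one containing $\mathrm{rt}(t)$, and $P_e(t)$ is the other one; a subtree is rooted at its vertex at minimal distance in $t$ from $\mathrm{rt}(t)$. For $s,t\in\mathbb{T}$ and $v\in V(s)$, $s\cup_v t$ is the rooted tree obtained by joining the root of $t$ to $s$ at $v$ by a single new edge, with root $\mathrm{rt}(s)$. For $t_1,t_2,t_3\in\mathbb{T}$ put $$\alpha(t_1,t_2,t_3)=|\{e\in E(t_2)\mid R_e(t_2)=t_3,\ P_e(t_2)=t_1\}|,\qquad \beta(t_1,t_2,t_3)=|\{v\in V(t_3)\mid t_1=t_3\cup_v t_2\}|.$$ The insertion-elimination algebra $\mathfrak{g}$ is the Lie algebra over $\mathbb{C}$ with basis $\{d\}\cup\{D_t^{+},D_t^-\mid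 t\in\mathbb{T}\}$ and relations, for $s,t\in\mathbb{T}$: $[D_s^+,D_t^+]=\sum_{r\in\mathbb{T}}(\beta(r,s,t)-\beta(r,t,s))D_r^+$; $[D_s^-,D_t^-]=\sum_{r\in\mathbb{T}}(\alpha(t,r,s)-\alpha(s,r,t))D_r^-$; $[D_s^-,D_t^+]=\sum_{r\in\mathbb{T}}\alpha(s,t,r)D_r^++\sum_{r\in\mathbb{T}}\beta(s,t,r)D_r^-$ for $s\neq t$; $[D_t^-,D_t^+]=d$; $[d,D_t^-]=-|t|D_t^-$; $[d,D_t^+]=|t|D_t^+$. A nonzero element $x$ of a Lie algebra $\mathfrak{L}$ over a field $\mathbb{F}$ is self-centralizing in $\mathfrak{L}$ if, for $y\in\mathfrak{L}$, $[x,y]=0$ implies $y\in\mathbb{F}x$. A Lie algebra $\mathfrak{L}$ with $\dim\mathfrak{L}>1$ is completely self-centralizing if every nonzero element of $\mathfrak{L}$ is self-centralizing in $\mathfrak{L}$. *)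

theory Defs
  imports Complex_Main "HOL-Library.Groups_Big_Fun"
begin

section \<open>Rooted trees\<close>

record 'a rgraph =
  verts :: "'a set"
  edges :: "'a set set"
  root :: 'a

definition adj :: "'a rgraph \<Rightarrow> 'a rel" where
  "adj t = {(u, v). {u, v} \<in> edges t}"

definition cycle :: "'a rgraph \<Rightarrow> 'a list \<Rightarrow> bool" where
  "cycle t vs \<longleftrightarrow> 3 \<le> length vs \<and> distinct vs
     \<and> successively (\<lambda>u v. {u, v} \<in> edges t) vs \<and> {last vs, hd vs} \<in> edges t"

definition rooted_tree :: "'a rgraph \<Rightarrow> bool" where
  "rooted_tree t \<longleftrightarrow> finite (verts t) \<and> root t \<in> verts t
     \<and> (\<forall>e \<in> edges t. e \<subseteq> verts t \<and> card e = 2)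
     \<and> (\<forall>u \<in> verts t. \<forall>v \<in> verts t. (u, v) \<in> (adj t)\<^sup>*)
     \<and> (\<nexists>vs. cycle t vs)"

text \<open>The vertex types may differ, so that a tree can be compared with a grafted one.\<close>

definition rooted_iso :: "'a rgraph \<Rightarrow> 'b rgraph \<Rightarrow> bool"  (infix "\<simeq>" 50) where
  "s \<simeq> t \<longleftrightarrow> (\<exists>f. bij_betw f (verts s) (verts t) \<and> f (root s) = root t
     \<and> (\<forall>u \<in> verts s. \<forall>v \<in> verts s. {u, v} \<in> edges s \<longleftrightarrow> {f u, f v} \<in> edges t))"

definition tree_dist :: "'a rgraph \<Rightarrow> 'a \<Rightarrow> 'a \<Rightarrow> nat" where
  "tree_dist t u v = (LEAST n. (u, v) \<in> adj t ^^ n)"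

text \<open>The subtree with vertex set \<open>W\<close>; in a tree the minimum that defines its root is attained
  at a single vertex.\<close>

definition subtree_on :: "'a rgraph \<Rightarrow> 'a set \<Rightarrow> 'a rgraph" where
  "subtree_on t W = \<lparr>verts = W, edges = {f \<in> edges t. f \<subseteq> W},
     root = arg_min_on (tree_dist t (root t)) W\<rparr>"

text \<open>The vertices joined to the root without using the edge \<open>e\<close>. In a tree \<open>e\<close> connects this set
  to its complement, so it is an edge of neither part below.\<close>

definition root_part :: "'a rgraph \<Rightarrow> 'a set \<Rightarrow> 'a set" where
  "root_part t e = {v \<in> verts t. (root t, v) \<in> (adj (t\<lparr>edges := edges t - {e}\<rparr>))\<^sup>*}"

definition R_part :: "'a set \<Rightarrow> 'a rgraph \<Rightarrow> 'a rgraph" where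
  "R_part e t = subtree_on t (root_part t e)"

definition P_part :: "'a set \<Rightarrow> 'a rgraph \<Rightarrow> 'a rgraph" where
  "P_part e t = subtree_on t (verts t - root_part t e)"

definition graft :: "'a rgraph \<Rightarrow> 'a \<Rightarrow> 'b rgraph \<Rightarrow> ('a + 'b) rgraph" where
  "graft s v t = \<lparr>verts = verts s <+> verts t,
     edges = (image Inl ` edges s) \<union> (image Inr ` edges t) \<union> {{Inl v, Inr (root t)}},
     root = Inl (root s)\<rparr>"

subsection \<open>Isomorphism classes\<close>

definition same_tree :: "'a rgraph \<Rightarrow> 'b rgraph \<Rightarrow> bool" where
  "same_tree s t \<longleftrightarrow> rooted_tree s \<and> rooted_tree t \<and> s \<simeq> t"

lemma same_tree_sym:
  assumes "same_tree s t" shows "same_tree t s"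
proof -
  obtain f where f: "bij_betw f (verts s) (verts t)" "f (root s) = root t"
    and e: "\<And>u v. u \<in> verts s \<Longrightarrow> v \<in> verts s \<Longrightarrow> {u, v} \<in> edges s \<longleftrightarrow> {f u, f v} \<in> edges t"
    using assms unfolding same_tree_def rooted_iso_def by blast
  let ?g = "inv_into (verts s) f"
  have "root s \<in> verts s"
    using assms by (simp add: same_tree_def rooted_tree_def)
  then have "?g (root t) = root s"
    using f by (metis bij_betw_inv_into_left)
  moreover have "{u, v} \<in> edges t \<longleftrightarrow> {?g u, ?g v} \<in> edges s"
    if uv: "u \<in> verts t" "v \<in> verts t" for u v
  proof -
    have "?g u \<in> verts s" "?g v \<in> verts s"
      using bij_betw_apply[OF bij_betw_inv_into[OF f(1)]] uv by auto
    from e[OF this] show ?thesis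
      by (simp add: bij_betw_inv_into_right[OF f(1) uv(1)] bij_betw_inv_into_right[OF f(1) uv(2)])
  qed
  ultimately have "t \<simeq> s"
    unfolding rooted_iso_def using bij_betw_inv_into[OF f(1)] by (intro exI[of _ ?g]) simp
  then show ?thesis
    using assms by (simp add: same_tree_def)
qed

lemma same_tree_trans:
  assumes "same_tree r s" "same_tree s t" shows "same_tree r t"
proof -
  obtain f g where fg: "bij_betw f (verts r) (verts s)" "bij_betw g (verts s) (verts t)"
      "f (root r) = root s" "g (root s) = root t"
    and ef: "\<forall>u \<in> verts r. \<forall>v \<in> verts r. {u, v} \<in> edges r \<longleftrightarrow> {f u, f v} \<in> edges s"
    and eg: "\<forall>u \<in> verts s. \<forall>v \<in> verts s. {u, v} \<in> edges s \<longleftrightarrow> {g u, g v} \<in> edges t"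
    using assms unfolding same_tree_def rooted_iso_def by blast
  have "\<forall>u \<in> verts r. \<forall>v \<in> verts r. {u, v} \<in> edges r \<longleftrightarrow> {(g \<circ> f) u, (g \<circ> f) v} \<in> edges t"
    using ef eg bij_betw_apply[OF fg(1)] by simp
  moreover have "bij_betw (g \<circ> f) (verts r) (verts t)"
    using fg(1,2) by (rule bij_betw_trans)
  moreover have "(g \<circ> f) (root r) = root t"
    using fg by simp
  ultimately have "r \<simeq> t"
    unfolding rooted_iso_def by (intro exI[of _ "g \<circ> f"] conjI)
  then show ?thesis
    using assms by (simp add: same_tree_def)
qed

lemma rooted_tree_singleton: "rooted_tree \<lparr>verts = {x}, edges = {}, root = x\<rparr>"
proof -
  have "\<not> cycle \<lparr>verts = {x}, edges = {}, root = x\<rparr> vs" for vs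
    by (simp add: cycle_def)
  then show ?thesis
    by (simp add: rooted_tree_def)
qed

text \<open>Every rooted tree has a copy whose vertices are natural numbers.\<close>

quotient_type itree = "nat rgraph" / partial: same_tree
  morphisms rep_itree abs_itree
proof (rule part_equivpI)
  have "\<And>t. t \<simeq> t"
    unfolding rooted_iso_def by (rule exI[of _ id]) auto
  then show "\<exists>t :: nat rgraph. same_tree t t"
    using rooted_tree_singleton[of "0 :: nat"] by (auto simp: same_tree_def)
  show "symp same_tree" by (blast intro: sympI same_tree_sym)
  show "transp same_tree" by (blast intro: transpI same_tree_trans)
qed

definition tree_size :: "itree \<Rightarrow> nat" where
  "tree_size t = card (verts (rep_itree t))"

definition alpha :: "itree \<Rightarrow> itree \<Rightarrow> itree \<Rightarrow> nat" where
  "alpha t1 t2 t3 = card {e \<in> edges (rep_itree t2).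
     R_part e (rep_itree t2) \<simeq> rep_itree t3 \<and> P_part e (rep_itree t2) \<simeq> rep_itree t1}"

definition beta :: "itree \<Rightarrow> itree \<Rightarrow> itree \<Rightarrow> nat" where
  "beta t1 t2 t3 = card {v \<in> verts (rep_itree t3).
     rep_itree t1 \<simeq> graft (rep_itree t3) v (rep_itree t2)}"

section \<open>Lie algebras\<close>

locale lie_algebra = vector_space scale
  for scale :: "'f::field \<Rightarrow> 'g::ab_group_add \<Rightarrow> 'g"  (infixr "*s" 75) +
  fixes bracket :: "'g \<Rightarrow> 'g \<Rightarrow> 'g"  ("\<lbrakk>_, _\<rbrakk>")
  assumes bracket_add_left: "\<lbrakk>x + y, z\<rbrakk> = \<lbrakk>x, z\<rbrakk> + \<lbrakk>y, z\<rbrakk>"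
    and bracket_add_right: "\<lbrakk>x, y + z\<rbrakk> = \<lbrakk>x, y\<rbrakk> + \<lbrakk>x, z\<rbrakk>"
    and bracket_scale_left: "\<lbrakk>c *s x, y\<rbrakk> = c *s \<lbrakk>x, y\<rbrakk>"
    and bracket_scale_right: "\<lbrakk>x, c *s y\<rbrakk> = c *s \<lbrakk>x, y\<rbrakk>"
    and bracket_self: "\<lbrakk>x, x\<rbrakk> = 0"
    and jacobi: "\<lbrakk>x, \<lbrakk>y, z\<rbrakk>\<rbrakk> + \<lbrakk>y, \<lbrakk>z, x\<rbrakk>\<rbrakk> + \<lbrakk>z, \<lbrakk>x, y\<rbrakk>\<rbrakk> = 0"
begin

definition lie_subalgebra :: "'g set \<Rightarrow> bool" where
  "lie_subalgebra L \<longleftrightarrow> subspace L \<and> (\<forall>x \<in> L. \<forall>y \<in> L. \<lbrakk>x, y\<rbrakk> \<in> L)"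

definition self_centralizing_in :: "'g set \<Rightarrow> 'g \<Rightarrow> bool" where
  "self_centralizing_in L x \<longleftrightarrow> x \<in> L \<and> x \<noteq> 0
     \<and> (\<forall>y \<in> L. \<lbrakk>x, y\<rbrakk> = 0 \<longrightarrow> (\<exists>c. y = c *s x))"

text \<open>A subalgebra \<open>L\<close> is considered as a Lie algebra in its own right. The condition that its
  dimension exceeds 1 is stated with a basis, because \<^const>\<open>dim\<close> is 0 in infinite dimension.\<close>

definition completely_self_centralizing :: "'g set \<Rightarrow> bool" where
  "completely_self_centralizing L \<longleftrightarrow> lie_subalgebra L
     \<and> (\<exists>B. B \<subseteq> L \<and> independent B \<and> span B = L \<and> (infinite B \<or> card B > 1))
     \<and> (\<forall>x \<in> L. x \<noteq> 0 \<longrightarrow> self_centralizing_in L x)"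

end

section \<open>The insertion-elimination algebra\<close>

text \<open>The algebra is given by its basis and relations, which determine it up to isomorphism.
  Every sum over all trees below has only finitely many nonzero terms, since
  \<^term>\<open>alpha s t r \<noteq> 0\<close> and \<^term>\<open>beta t s r \<noteq> 0\<close> both force
  \<^term>\<open>tree_size t = tree_size s + tree_size r\<close> and there are finitely many trees of each
  size; so \<^const>\<open>Sum_any\<close>, which is 0 on infinite support, is the intended sum.\<close>

locale insertion_elimination_algebra = lie_algebra scale bracket
  for scale :: "complex \<Rightarrow> 'g::ab_group_add \<Rightarrow> 'g"  (infixr "*s" 75)
    and bracket :: "'g \<Rightarrow> 'g \<Rightarrow> 'g"  ("\<lbrakk>_, _\<rbrakk>") +
  fixes d :: 'g and Dp Dm :: "itree \<Rightarrow> 'g"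
  assumes basis_distinct: "inj Dp" "inj Dm" "range Dp \<inter> range Dm = {}" "d \<notin> range Dp \<union> range Dm"
    and basis_independent: "independent ({d} \<union> range Dp \<union> range Dm)"
    and basis_span: "span ({d} \<union> range Dp \<union> range Dm) = UNIV"
    and bracket_Dp_Dp: "\<lbrakk>Dp s, Dp t\<rbrakk> =
      Sum_any (\<lambda>r. (of_nat (beta r s t) - of_nat (beta r t s)) *s Dp r)"
    and bracket_Dm_Dm: "\<lbrakk>Dm s, Dm t\<rbrakk> =
      Sum_any (\<lambda>r. (of_nat (alpha t r s) - of_nat (alpha s r t)) *s Dm r)"
    and bracket_Dm_Dp: "s \<noteq> t \<Longrightarrow> \<lbrakk>Dm s, Dp t\<rbrakk> =
      Sum_any (\<lambda>r. of_nat (alpha s t r) *s Dp r) + Sum_any (\<lambda>r. of_nat (beta s t r) *s Dm r)"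
    and bracket_Dm_Dp_same: "\<lbrakk>Dm t, Dp t\<rbrakk> = d"
    and bracket_d_Dm: "\<lbrakk>d, Dm t\<rbrakk> = - of_nat (tree_size t) *s Dm t"
    and bracket_d_Dp: "\<lbrakk>d, Dp t\<rbrakk> = of_nat (tree_size t) *s Dp t"
begin

definition g_plus :: "'g set" where
  "g_plus = span (range Dp)"

definition g_minus :: "'g set" where
  "g_minus = span (range Dm)"

end

end

theory Submission
  imports Defs "HOL-Library.Transitive_Closure_Table"
begin

text \<open>
  Write \<open>u \<triangleleft> v\<close> for the tree that grafts \<open>v\<close> at the root of \<open>u\<close>. Up to sign, the bracket of two basis
  vectors of \<open>g\<^sup>+\<close>, or of \<open>g\<^sup>-\<close>, belonging to \<open>s\<close> and \<open>t\<close> sums the graftings of \<open>t\<close> at the vertices of \<open>s\<close>,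
  with positive multiplicities, and subtracts those of \<open>s\<close> at the vertices of \<open>t\<close>. In \<open>g\<^sup>+\<close> the
  multiplicities are values of \<^const>\<open>beta\<close>, in \<open>g\<^sup>-\<close> values of \<^const>\<open>alpha\<close>; only the trees that occur
  matter below, not how often, and they are the same trees in both cases
  (\<open>beta_nonzero_iff\<close>, \<open>alpha_nonzero_iff\<close>). Hence one argument serves for both algebras.

  The argument isolates coefficients of the bracket of two vectors \<open>x\<close> and \<open>y\<close> by the root degree. A
  grafting raises it by one if it is done at the root, and keeps it otherwise. Thus if \<open>w\<close> has
  maximal root degree among the trees occurring in \<open>x\<close> and \<open>y\<close>, the coefficient at \<open>w \<triangleleft> a\<close> involves
  only equations \<open>u \<triangleleft> v = w \<triangleleft> a\<close>. Such an equation means that \<open>u = w\<close> and \<open>v = a\<close>, or that \<open>a\<close> is a root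
  branch of \<open>u\<close> and \<open>v\<close> one of \<open>w\<close> (\<open>root_graft_refinement\<close>), and a good choice of \<open>w\<close> and \<open>a\<close> excludes the
  second case.

  Suppose that \<open>x\<close> and \<open>y\<close> commute and are not zero. Their maximal root degrees agree
  (\<open>commuting_degree_le\<close>): otherwise take \<open>a\<close> in the vector with the smaller one and, in the
  other, \<open>w\<close> of top degree with as many branches \<open>a\<close> as possible. Now let \<open>a\<close> be a tree of largest
  size in \<open>x\<close> and \<open>y\<close>, say in \<open>x\<close>, and subtract from \<open>y\<close> a multiple of \<open>x\<close> so that \<open>a\<close> no longer occurs in
  \<open>y\<close>. The new \<open>y\<close> commutes with \<open>x\<close> as well. If it is not zero, it contains a tree \<open>w\<close> of the common
  maximal root degree; since \<open>a\<close> is not a branch of any tree that occurs, the coefficient at \<open>w \<triangleleft> a\<close> is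
  not zero, a contradiction (\<open>commuting_proportional_largest\<close>). Hence \<open>y\<close> was a multiple of \<open>x\<close>.

  On the side of graphs, everything rests on the fact that cutting at an edge and grafting are
  inverse to each other up to isomorphism (\<open>graft_parts\<close>, \<open>parts_graft\<close>).
\<close>

section \<open>Commuting combinations of trees\<close>

text \<open>Here \<open>u \<triangleleft> v\<close> is the tree that grafts \<open>v\<close> at the root of \<open>u\<close>, \<open>deg\<close> is the number of children of
  the root, and \<open>N r u v\<close> counts the ways to obtain \<open>r\<close> by grafting \<open>v\<close> at some vertex of \<open>u\<close>. A grafting
  away from the root keeps the root degree, which is what \<open>count_deg\<close> and \<open>count_top\<close> record. The
  value of \<open>N\<close> is left open apart from its support, so that both \<^const>\<open>beta\<close> and \<^const>\<open>alpha\<close> are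
  instances.

  If trees are identified with the multisets of their root branches, \<open>\<triangleleft>\<close> adds one element to a
  multiset and \<open>refinement\<close> says when two multisets agree after adding one element to each. Together
  with the size it is all that is used about branches; it contains the cancellation law \<open>v = b\<close>.\<close>

locale root_grafting =
  fixes rg :: "'a \<Rightarrow> 'a \<Rightarrow> 'a"  (infixl "\<triangleleft>" 70)
    and sz deg :: "'a \<Rightarrow> nat"
    and N :: "'a \<Rightarrow> 'a \<Rightarrow> 'a \<Rightarrow> nat"
  assumes refinement: "u \<triangleleft> v = w \<triangleleft> b \<Longrightarrow> (u = w \<and> v = b) \<or> (\<exists>z. u = z \<triangleleft> b \<and> w = z \<triangleleft> v)"
    and size_graft: "sz (u \<triangleleft> v) = sz u + sz v"
    and size_pos: "0 < sz u"
    and deg_graft: "deg (u \<triangleleft> v) = Suc (deg u)"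
    and count_root: "N (u \<triangleleft> v) u v \<noteq> 0"
    and count_deg: "N r u v \<noteq> 0 \<Longrightarrow> deg r \<le> Suc (deg u)"
    and count_top: "N r u v \<noteq> 0 \<Longrightarrow> deg r = Suc (deg u) \<Longrightarrow> r = u \<triangleleft> v"
    and finite_count: "finite {r. N r u v \<noteq> 0}"
begin

abbreviation graft_copies :: "'a \<Rightarrow> nat \<Rightarrow> 'a \<Rightarrow> 'a" where
  "graft_copies b k z \<equiv> ((\<lambda>u. u \<triangleleft> b) ^^ k) z"

text \<open>The multiplicity of \<open>b\<close> among the root branches is expressed by peeling off copies of \<open>b\<close>: if
  \<open>w \<triangleleft> v\<close> has \<open>k\<close> branches \<open>b\<close> and \<open>v \<noteq> b\<close>, then all of them are branches of \<open>w\<close>, by \<open>k\<close> applications of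
  the refinement property.\<close>

lemma graft_copies_refinement:
  assumes "graft_copies b k z = w \<triangleleft> v" "v \<noteq> b"
  shows "\<exists>z'. w = graft_copies b k z'"
  using assms(1)
proof (induction k arbitrary: w)
  case 0
  show ?case by (intro exI[of _ w]) simp
next
  case (Suc k)
  then have "graft_copies b k z \<triangleleft> b = w \<triangleleft> v" by simp
  with assms(2) obtain y where y: "graft_copies b k z = y \<triangleleft> v" "w = y \<triangleleft> b"
    using refinement by blast
  obtain z' where "y = graft_copies b k z'"
    using Suc.IH[OF y(1)] by blast
  with y(2) have "w = graft_copies b (Suc k) z'" by simp
  then show ?case by blast
qed

lemma graft_copies_le_size: "k \<le> sz (graft_copies b k z)"
proof (induction k)
  case (Suc k)
  then show ?case using size_pos[of b] by (simp add: size_graft)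
qed simp

lemma graft_eq_copies:
  assumes "u \<triangleleft> v = graft_copies b k z \<triangleleft> b"
  shows "(u = graft_copies b k z \<and> v = b) \<or> (\<exists>z'. u = graft_copies b (Suc k) z')"
proof (cases "v = b")
  case True
  with refinement[OF assms] show ?thesis by auto
next
  case False
  have "graft_copies b (Suc k) z = u \<triangleleft> v" using assms by simp
  from graft_copies_refinement[OF this False] show ?thesis by blast
qed

text \<open>Up to a nonzero constant, the coefficient at the basis vector of \<open>r\<close> of the bracket of the
  vectors with coordinates \<open>x\<close> and \<open>y\<close>, both supported in \<open>S\<close>.\<close>

definition bracket_coeff :: "'a set \<Rightarrow> ('a \<Rightarrow> 'f::field_char_0) \<Rightarrow> ('a \<Rightarrow> 'f) \<Rightarrow> 'a \<Rightarrow> 'f" where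
  "bracket_coeff S x y r = (\<Sum>u\<in>S. \<Sum>v\<in>S. x u * y v * (of_nat (N r u v) - of_nat (N r v u)))"

lemma bracket_coeff_alt:
  "bracket_coeff S x y r = (\<Sum>u\<in>S. \<Sum>v\<in>S. (x u * y v - y u * x v) * of_nat (N r u v))"
proof -
  have "(\<Sum>u\<in>S. \<Sum>v\<in>S. x u * y v * of_nat (N r v u)) = (\<Sum>u\<in>S. \<Sum>v\<in>S. y u * x v * of_nat (N r u v))"
    by (subst sum.swap) (simp add: mult.commute)
  then show ?thesis
    unfolding bracket_coeff_def by (simp add: algebra_simps sum_subtractf)
qed

lemma bracket_coeff_swap: "bracket_coeff S y x r = - bracket_coeff S x y r"
  unfolding bracket_coeff_alt sum_negf[symmetric]
  by (intro sum.cong refl) (simp add: algebra_simps)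

text \<open>The centralizer of \<open>x\<close> is a subspace that contains \<open>x\<close>.\<close>

lemma bracket_coeff_shear:
  "bracket_coeff S x (\<lambda>u. y u - c * x u) r = bracket_coeff S x y r"
  unfolding bracket_coeff_alt by (intro sum.cong refl) (simp add: algebra_simps)

text \<open>The tree \<open>w \<triangleleft> a\<close> has root degree one more than \<open>w\<close>. If no pair \<open>(u, v)\<close> that contributes to the bracket
  has \<open>deg u > deg w\<close>, then \<open>w \<triangleleft> a\<close> arises from such a pair only by grafting at the root and with
  \<open>deg u = deg w\<close>. So if \<open>(w, a)\<close> is the only factorization of \<open>w \<triangleleft> a\<close> among these pairs, the
  coefficient at \<open>w \<triangleleft> a\<close> is the minor of \<open>x\<close> and \<open>y\<close> at \<open>w, a\<close> times a positive integer.\<close>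

lemma bracket_coeff_isolated:
  assumes "finite S" "w \<in> S" "a \<in> S"
    and isolated: "\<And>u v. \<lbrakk>u \<in> S; v \<in> S; x u * y v \<noteq> y u * x v\<rbrakk>
      \<Longrightarrow> deg u \<le> deg w \<and> (deg u = deg w \<and> u \<triangleleft> v = w \<triangleleft> a \<longrightarrow> u = w \<and> v = a)"
    and zero: "bracket_coeff S x y (w \<triangleleft> a) = 0"
  shows "x w * y a = y w * x a"
proof -
  let ?f = "\<lambda>u v. (x u * y v - y u * x v) * of_nat (N (w \<triangleleft> a) u v)"
  have other: "?f u v = 0" if "u \<in> S" "v \<in> S" "(u, v) \<noteq> (w, a)" for u v
  proof (rule ccontr)
    assume "?f u v \<noteq> 0"
    then have ne: "x u * y v \<noteq> y u * x v" and N: "N (w \<triangleleft> a) u v \<noteq> 0"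
      by auto
    have "deg u = deg w"
      using isolated[OF that(1,2) ne] count_deg[OF N] by (simp add: deg_graft)
    with count_top[OF N] isolated[OF that(1,2) ne] that(3) show False
      by (simp add: deg_graft)
  qed
  have "0 = (\<Sum>p\<in>S \<times> S. ?f (fst p) (snd p))"
    using zero by (simp add: bracket_coeff_alt sum.cartesian_product case_prod_beta)
  also have "\<dots> = (\<Sum>p\<in>{(w, a)}. ?f (fst p) (snd p))"
    using assms(1-3) other by (intro sum.mono_neutral_right) (simp, simp, force)
  finally show ?thesis
    using count_root[of w a] by simp
qed

text \<open>Commuting nonzero vectors have the same maximal root degree. Otherwise let \<open>x\<close> have the larger
  one, \<open>p\<close>. At trees of root degree \<open>p + 1\<close> only grafting a tree of \<open>y\<close> onto the root of a tree of \<open>x\<close>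
  contributes. For a tree \<open>b\<close> of \<open>y\<close>, among the trees of root degree \<open>p\<close> in \<open>x\<close> take one, \<open>w\<close>, with the
  most root branches \<open>b\<close>. In another factorization \<open>u \<triangleleft> v\<close> of \<open>w \<triangleleft> b\<close> the tree \<open>u\<close> would have
  one more branch \<open>b\<close> than \<open>w\<close>, so the coefficient at \<open>w \<triangleleft> b\<close> does not vanish.\<close>

lemma commuting_degree_le:
  assumes S: "finite S" and zero: "\<And>r. bracket_coeff S x y r = 0"
    and w: "w \<in> S" "x w \<noteq> 0" and b: "b \<in> S" "y b \<noteq> 0"
  shows "\<exists>w'\<in>S. y w' \<noteq> 0 \<and> deg w \<le> deg w'"
proof (rule ccontr)
  assume "\<not> ?thesis"
  then have low: "deg v < deg w" if "v \<in> S" "y v \<noteq> 0" for v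
    using that by force
  define p where "p = Max (deg ` {u \<in> S. x u \<noteq> 0})"
  have p: "deg u \<le> p" if "u \<in> S" "x u \<noteq> 0" for u
    unfolding p_def using S that by (intro Max_ge) auto
  have "p \<in> deg ` {u \<in> S. x u \<noteq> 0}"
    unfolding p_def using S w by (intro Max_in) auto
  then obtain w0 where w0: "w0 \<in> S" "x w0 \<noteq> 0" "deg w0 = p"
    by auto
  \<comment> \<open>The numbers of copies of \<open>b\<close> that can be peeled off the trees of top degree in \<open>x\<close>.\<close>
  define K where "K = {k. \<exists>z. graft_copies b k z \<in> S \<and> x (graft_copies b k z) \<noteq> 0
    \<and> deg (graft_copies b k z) = p}"
  have "finite K"
  proof (rule finite_subset)
    show "K \<subseteq> {.. Max (sz ` S)}"
    proof
      fix k assume "k \<in> K"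
      then obtain z where "graft_copies b k z \<in> S" by (auto simp: K_def)
      then have "sz (graft_copies b k z) \<le> Max (sz ` S)" using S by simp
      with graft_copies_le_size[of k b z] show "k \<in> {.. Max (sz ` S)}" by simp
    qed
  qed simp
  moreover have K: "k \<in> K" if "x (graft_copies b k z) \<noteq> 0" "graft_copies b k z \<in> S"
      "deg (graft_copies b k z) = p" for k z
    using that by (auto simp: K_def)
  then have "0 \<in> K"
    using w0 by (metis funpow_0)
  ultimately have "Max K \<in> K" by (intro Max_in) auto
  then obtain z where z: "graft_copies b (Max K) z \<in> S" "x (graft_copies b (Max K) z) \<noteq> 0"
    "deg (graft_copies b (Max K) z) = p"
    by (auto simp: K_def)
  let ?m = "graft_copies b (Max K) z"
  have "x ?m * y b = y ?m * x b"
  proof (rule bracket_coeff_isolated[OF S z(1) b(1) _ zero])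
    fix u v assume uv: "u \<in> S" "v \<in> S" "x u * y v \<noteq> y u * x v"
    have "deg u \<le> p \<and> (deg u = p \<longrightarrow> x u \<noteq> 0)"
      using p[OF uv(1)] low[OF uv(1)] p[OF w] uv(3) by force
    moreover have "u = ?m \<and> v = b" if "deg u = p" "x u \<noteq> 0" "u \<triangleleft> v = ?m \<triangleleft> b"
    proof (rule ccontr)
      assume "\<not> ?thesis"
      with graft_eq_copies[OF that(3)] obtain z' where "u = graft_copies b (Suc (Max K)) z'"
        by blast
      with that(1,2) uv(1) have "Suc (Max K) \<in> K"
        using K by metis
      with \<open>finite K\<close> show False
        using Max_ge not_less_eq_eq by blast
    qed
    ultimately show "deg u \<le> deg ?m \<and> (deg u = deg ?m \<and> u \<triangleleft> v = ?m \<triangleleft> b \<longrightarrow> u = ?m \<and> v = b)"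
      using z(3) by blast
  qed
  moreover have "y ?m = 0"
    using low[OF z(1)] p[OF w] z(3) by force
  ultimately show False
    using z(2) b(2) by simp
qed

text \<open>Let \<open>a\<close> be a tree of largest size in \<open>x\<close> and \<open>y\<close>, and subtract from \<open>y\<close> the multiple of \<open>x\<close> that cancels its
  coordinate at \<open>a\<close>. Were the difference \<open>y'\<close> nonzero, it would have the same maximal root degree as
  \<open>x\<close>, attained at a tree \<open>w\<close>. The tree \<open>w \<triangleleft> a\<close> has no factorization \<open>u \<triangleleft> v\<close> in which \<open>a\<close> is a branch of
  \<open>u\<close>, because \<open>u\<close> would be larger than \<open>a\<close>. So its coefficient in the bracket of \<open>x\<close> and \<open>y'\<close> is a
  nonzero multiple of the product of the coordinates \<open>y' w\<close> and \<open>x a\<close>, which is not zero.\<close>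

lemma commuting_proportional_largest:
  assumes S: "finite S" and zero: "\<And>r. bracket_coeff S x y r = 0"
    and a: "a \<in> S" "x a \<noteq> 0"
    and largest: "\<And>u. \<lbrakk>u \<in> S; x u \<noteq> 0 \<or> y u \<noteq> 0\<rbrakk> \<Longrightarrow> sz u \<le> sz a"
  shows "\<exists>c. \<forall>u\<in>S. y u = c * x u"
proof (rule ccontr)
  assume not: "\<not> ?thesis"
  define y' where "y' = (\<lambda>u. y u - y a / x a * x u)"
  have zero': "bracket_coeff S x y' r = 0" for r
    unfolding y'_def bracket_coeff_shear by (rule zero)
  have y'a: "y' a = 0" using a by (simp add: y'_def)
  from not have "\<exists>v\<in>S. y v \<noteq> y a / x a * x v" by blast
  then obtain v where v: "v \<in> S" "y' v \<noteq> 0"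
    unfolding y'_def by auto
  define p where "p = Max (deg ` {u \<in> S. y' u \<noteq> 0})"
  have p: "deg u \<le> p" if "u \<in> S" "y' u \<noteq> 0" for u
    unfolding p_def using S that by (intro Max_ge) auto
  have "p \<in> deg ` {u \<in> S. y' u \<noteq> 0}"
    unfolding p_def using S v by (intro Max_in) auto
  then obtain w where w: "w \<in> S" "y' w \<noteq> 0" "deg w = p"
    by auto
  have px: "deg u \<le> p" if "u \<in> S" "x u \<noteq> 0" for u
    using commuting_degree_le[OF S zero' that v] p by force
  have "x w * y' a = y' w * x a"
  proof (rule bracket_coeff_isolated[OF S w(1) a(1) _ zero'])
    fix u v assume uv: "u \<in> S" "v \<in> S" "x u * y' v \<noteq> y' u * x v"
    then have u: "x u \<noteq> 0 \<or> y' u \<noteq> 0" by auto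
    then have "sz u \<le> sz a"
      using largest[OF uv(1)] by (auto simp: y'_def)
    \<comment> \<open>A tree with a branch \<open>a\<close> is larger than \<open>a\<close>, the largest tree.\<close>
    then have "\<nexists>z. u = z \<triangleleft> a"
      using size_pos by (auto simp: size_graft) (metis less_irrefl)
    then show "deg u \<le> deg w \<and> (deg u = deg w \<and> u \<triangleleft> v = w \<triangleleft> a \<longrightarrow> u = w \<and> v = a)"
      using u px[OF uv(1)] p[OF uv(1)] w(3) refinement[of u v w a] by blast
  qed
  with y'a w(2) a(2) show False by simp
qed

lemma commuting_proportional:
  assumes S: "finite S" and zero: "\<And>r. bracket_coeff S x y r = 0"
    and x: "u0 \<in> S" "x u0 \<noteq> 0"
  shows "\<exists>c. \<forall>u\<in>S. y u = c * x u"
proof -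
  define n where "n = Max (sz ` {u \<in> S. x u \<noteq> 0 \<or> y u \<noteq> 0})"
  have n: "sz u \<le> n" if "u \<in> S" "x u \<noteq> 0 \<or> y u \<noteq> 0" for u
    unfolding n_def using S that by (intro Max_ge) auto
  have "n \<in> sz ` {u \<in> S. x u \<noteq> 0 \<or> y u \<noteq> 0}"
    unfolding n_def using S x by (intro Max_in) auto
  then obtain a where a: "a \<in> S" "x a \<noteq> 0 \<or> y a \<noteq> 0" "sz a = n"
    by auto
  show ?thesis
  proof (cases "x a = 0")
    case False
    with commuting_proportional_largest[OF S zero a(1)] n a(3) show ?thesis by auto
  next
    case True
    then have "y a \<noteq> 0" using a(2) by simp
    moreover have "bracket_coeff S y x r = 0" for r
      by (simp add: bracket_coeff_swap[of S y] zero)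
    ultimately obtain c where c: "\<forall>u\<in>S. x u = c * y u"
      using commuting_proportional_largest[OF S _ a(1), of y x] n a(3) by auto
    then have "c \<noteq> 0" using x by auto
    with c have "\<forall>u\<in>S. y u = inverse c * x u" by simp
    then show ?thesis by blast
  qed
qed

section \<open>Passage to the Lie algebra\<close>

text \<open>The factor \<open>e\<close> absorbs the opposite sign conventions of the brackets of the \<open>D\<^sub>t\<^sup>+\<close> and of the
  \<open>D\<^sub>t\<^sup>-\<close>.\<close>

theorem completely_self_centralizing_span:
  fixes scale :: "'f::field_char_0 \<Rightarrow> 'g::ab_group_add \<Rightarrow> 'g" and e :: 'f
  assumes "lie_algebra scale bracket" and inj: "inj D"
    and indep: "\<not> module.dependent scale (range D)" and e: "e \<noteq> 0"
    and br: "\<And>s t. bracket (D s) (D t) =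
      Sum_any (\<lambda>r. scale (e * (of_nat (N r s t) - of_nat (N r t s))) (D r))"
  shows "lie_algebra.completely_self_centralizing scale bracket (module.span scale (range D))"
proof -
  interpret lie_algebra scale bracket by fact
  have zl: "bracket 0 y = 0" for y
    using bracket_add_left[of 0 0 y] by simp
  have zr: "bracket y 0 = 0" for y
    using bracket_add_right[of y 0 0] by simp
  have sum_left: "bracket (sum f A) y = (\<Sum>i\<in>A. bracket (f i) y)" for f A y
    by (induction A rule: infinite_finite_induct) (simp_all add: zl bracket_add_left)
  have sum_right: "bracket y (sum f A) = (\<Sum>i\<in>A. bracket y (f i))" for f A y
    by (induction A rule: infinite_finite_induct) (simp_all add: zr bracket_add_right)
  let ?L = "span (range D)"
  define coeff where "coeff x t = representation (range D) x (D t)" for x t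
  have coeff_expand: "(\<Sum>t\<in>S. scale (coeff x t) (D t)) = x"
    if "x \<in> ?L" "finite S" "{t. coeff x t \<noteq> 0} \<subseteq> S" for x S
  proof -
    have "(\<Sum>b\<in>D ` S. scale (representation (range D) x b) b)
        = (\<Sum>b | representation (range D) x b \<noteq> 0. scale (representation (range D) x b) b)"
    proof (rule sum.mono_neutral_right)
      show "{b. representation (range D) x b \<noteq> 0} \<subseteq> D ` S"
        using representation_ne_zero that(3) unfolding coeff_def by blast
    qed (use that(2) in auto)
    also have "\<dots> = x"
      by (rule sum_nonzero_representation_eq[OF indep that(1)])
    finally have "(\<Sum>b\<in>D ` S. scale (representation (range D) x b) b) = x" .
    then show ?thesis
      using inj by (simp add: sum.reindex inj_on_def coeff_def)
  qed
  have finite_coeff: "finite {t. coeff x t \<noteq> 0}" for x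
  proof -
    have "finite (D -` {b. representation (range D) x b \<noteq> 0})"
      using finite_representation inj by (rule finite_vimageI)
    then show ?thesis by (simp add: coeff_def vimage_def)
  qed
  have D_in: "D t \<in> ?L" for t by (simp add: span_base)
  have coeff_D: "coeff (D t) s = (if s = t then 1 else 0)" for s t
    using representation_basis[OF indep, of "D t"] inj by (auto simp: coeff_def inj_eq)
  have coeff_sum: "coeff (sum f A) t = (\<Sum>i\<in>A. coeff (f i) t)" if "\<And>i. i \<in> A \<Longrightarrow> f i \<in> ?L"
    for f :: "'b \<Rightarrow> 'g" and A t
    using representation_sum[OF indep, of A f] that by (simp add: coeff_def)
  have coeff_scale: "coeff (scale c x) t = c * coeff x t" if "x \<in> ?L" for c x t
    using representation_scale[OF indep that] by (simp add: coeff_def)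
  have coeff_sum_D: "coeff (\<Sum>r\<in>A. scale (c r) (D r)) t = (if t \<in> A then c t else 0)"
    if "finite A" for A c t
    using that by (simp add: coeff_sum span_scale D_in coeff_scale coeff_D if_distrib cong: if_cong)
  have br_in: "bracket (D s) (D t) \<in> ?L" for s t
    unfolding br Sum_any.expand_set by (intro span_sum span_scale D_in)
  have coeff_br: "coeff (bracket (D s) (D t)) r = e * (of_nat (N r s t) - of_nat (N r t s))" for s t r
  proof -
    have fin: "finite {r. 0 < N r u v}" for u v using finite_count[of u v] by simp
    let ?A = "{r. N r s t \<noteq> 0} \<union> {r. N r t s \<noteq> 0}"
    have "bracket (D s) (D t) =
      (\<Sum>r\<in>?A. scale (e * (of_nat (N r s t) - of_nat (N r t s))) (D r))"
      unfolding br by (rule Sum_any.expand_superset) (auto simp: fin)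
    then show ?thesis
      using coeff_sum_D[of ?A "\<lambda>r. e * (of_nat (N r s t) - of_nat (N r t s))" r]
      by (auto simp: fin)
  qed
  have br_expand: "bracket x y =
      (\<Sum>u\<in>S. \<Sum>v\<in>S. scale (coeff x u * coeff y v) (bracket (D u) (D v)))"
    if "x \<in> ?L" "y \<in> ?L" "finite S" "{t. coeff x t \<noteq> 0} \<subseteq> S" "{t. coeff y t \<noteq> 0} \<subseteq> S" for x y S
  proof -
    have "bracket x y = bracket (\<Sum>t\<in>S. scale (coeff x t) (D t)) (\<Sum>t\<in>S. scale (coeff y t) (D t))"
      using that by (simp add: coeff_expand)
    also have "\<dots> = (\<Sum>u\<in>S. \<Sum>v\<in>S. scale (coeff x u * coeff y v) (bracket (D u) (D v)))"
      unfolding sum_left unfolding sum_right by (simp add: bracket_scale_left bracket_scale_right mult.commute)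
    finally show ?thesis .
  qed
  have subalgebra: "lie_subalgebra ?L"
    unfolding lie_subalgebra_def
  proof (intro conjI ballI)
    fix x y assume xy: "x \<in> ?L" "y \<in> ?L"
    have "finite ({t. coeff x t \<noteq> 0} \<union> {t. coeff y t \<noteq> 0})" by (simp add: finite_coeff)
    from br_expand[OF xy this] have "bracket x y =
      (\<Sum>u\<in>{t. coeff x t \<noteq> 0} \<union> {t. coeff y t \<noteq> 0}. \<Sum>v\<in>{t. coeff x t \<noteq> 0} \<union> {t. coeff y t \<noteq> 0}.
        scale (coeff x u * coeff y v) (bracket (D u) (D v)))" by blast
    then show "bracket x y \<in> ?L"
      by (simp only:) (intro span_sum span_scale br_in)
  qed simp
  have centralizer: "\<exists>c. y = scale c x"
    if x: "x \<in> ?L" "x \<noteq> 0" and y: "y \<in> ?L" and comm: "bracket x y = 0" for x y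
  proof -
    define S where "S = {t. coeff x t \<noteq> 0} \<union> {t. coeff y t \<noteq> 0}"
    have S: "finite S" "{t. coeff x t \<noteq> 0} \<subseteq> S" "{t. coeff y t \<noteq> 0} \<subseteq> S"
      by (auto simp: S_def finite_coeff)
    have "bracket_coeff S (coeff x) (coeff y) r = 0" for r
    proof -
      have "0 = coeff (bracket x y) r"
        by (simp add: comm coeff_def representation_zero)
      also have "\<dots> = (\<Sum>u\<in>S. \<Sum>v\<in>S. coeff x u * coeff y v * coeff (bracket (D u) (D v)) r)"
        unfolding br_expand[OF x(1) y S]
        by (simp add: coeff_sum coeff_scale span_sum span_scale br_in)
      also have "\<dots> = e * bracket_coeff S (coeff x) (coeff y) r"
        unfolding bracket_coeff_def coeff_br sum_distrib_left
        by (intro sum.cong refl) simp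
      finally show ?thesis using e by simp
    qed
    moreover obtain u0 where "u0 \<in> S" "coeff x u0 \<noteq> 0"
    proof (rule ccontr)
      assume "\<not> thesis"
      with that S(2) have "coeff x t = 0" for t by blast
      with coeff_expand[OF x(1) S(1,2)] x(2) show False by simp
    qed
    ultimately obtain c where c: "\<forall>u\<in>S. coeff y u = c * coeff x u"
      using commuting_proportional[OF S(1)] by blast
    have "y = (\<Sum>t\<in>S. scale (coeff y t) (D t))"
      using y S by (simp add: coeff_expand)
    also have "\<dots> = scale c (\<Sum>t\<in>S. scale (coeff x t) (D t))"
      using c by (simp add: scale_sum_right)
    also have "\<dots> = scale c x"
      using x S by (simp add: coeff_expand)
    finally show ?thesis by blast
  qed
  have dim: "infinite (range D) \<or> 1 < card (range D)"
  proof (cases "finite (range D)")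
    case True
    fix u :: 'a
    have "sz (u \<triangleleft> u) \<noteq> sz u"
      using size_pos[of u] by (simp add: size_graft)
    then have "u \<triangleleft> u \<noteq> u" by metis
    then have "card {D u, D (u \<triangleleft> u)} = 2"
      using inj by (simp add: inj_eq)
    moreover have "card {D u, D (u \<triangleleft> u)} \<le> card (range D)"
      using True by (intro card_mono) auto
    ultimately show ?thesis by simp
  qed simp
  have "\<exists>B. B \<subseteq> ?L \<and> independent B \<and> span B = ?L \<and> (infinite B \<or> card B > 1)"
    using indep dim by (intro exI[of _ "range D"]) (auto simp: span_base)
  then show ?thesis
    unfolding completely_self_centralizing_def self_centralizing_in_def
    using subalgebra centralizer by blast
qed

end

section \<open>Walks and bridges\<close>

text \<open>All arguments about paths concern a tree with some edges or vertices removed, so reachability is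
  studied for a bare set of edges.\<close>

definition link :: "'a set set \<Rightarrow> 'a rel" where
  "link E = {(u, v). {u, v} \<in> E}"

lemma adj_eq_link: "adj t = link (edges t)"
  by (simp add: adj_def link_def)

lemma reach_sym: "(u, v) \<in> (link E)\<^sup>* \<Longrightarrow> (v, u) \<in> (link E)\<^sup>*"
  by (rule symD[OF sym_rtrancl]) (auto simp: sym_def link_def insert_commute)

text \<open>A map that sends every edge to a walk, possibly a trivial one, sends walks to walks. This covers
  relabellings, inclusions, and the retractions of a grafted tree onto its two pieces.\<close>

lemma reach_map:
  assumes "(u, v) \<in> (link E)\<^sup>*"
    and "\<And>a b. {a, b} \<in> E \<Longrightarrow> (h a, h b) \<in> (link F)\<^sup>*"
  shows "(h u, h v) \<in> (link F)\<^sup>*"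
  using assms(1)
proof (induction rule: rtrancl_induct)
  case (step y z)
  then have "(h y, h z) \<in> (link F)\<^sup>*"
    using assms(2) by (simp add: link_def)
  with step.IH show ?case by (rule rtrancl_trans)
qed simp

lemma reach_edge: "{u, v} \<in> E \<Longrightarrow> (u, v) \<in> (link E)\<^sup>*"
  by (rule r_into_rtrancl) (simp add: link_def)

lemma reach_mono:
  assumes "(u, v) \<in> (link E)\<^sup>*" "E \<subseteq> F" shows "(u, v) \<in> (link F)\<^sup>*"
  using reach_map[OF assms(1), of id F] assms(2) by (auto intro: reach_edge)

lemma reach_closed:
  assumes "(u, v) \<in> (link E)\<^sup>*" "u \<in> A" "\<And>a b. {a, b} \<in> E \<Longrightarrow> a \<in> A \<Longrightarrow> b \<in> A"
  shows "v \<in> A"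
  using assms(1,2) by (induction rule: rtrancl_induct) (auto simp: link_def intro: assms(3))

lemma rtrancl_path_successively:
  "rtrancl_path r x xs y \<Longrightarrow> successively r (x # xs) \<and> last (x # xs) = y"
  by (induction rule: rtrancl_path.induct) auto

text \<open>Removing an edge of a tree must disconnect its ends, and this criterion, unlike the list of
  vertices of a cycle, is easily transported along maps of graphs: a walk between the ends of an
  edge that avoids the edge can be made simple and closed up to a cycle, and conversely.\<close>

lemma acyclic_iff_bridges:
  assumes card2: "\<And>e. e \<in> edges t \<Longrightarrow> card e = 2"
  shows "(\<nexists>vs. cycle t vs) \<longleftrightarrow>
    (\<forall>u v. {u, v} \<in> edges t \<longrightarrow> (u, v) \<notin> (link (edges t - {{u, v}}))\<^sup>*)"
proof (intro iffI allI impI notI)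
  fix u v assume acyc: "\<nexists>vs. cycle t vs" and uv: "{u, v} \<in> edges t"
    and "(u, v) \<in> (link (edges t - {{u, v}}))\<^sup>*"
  then have "(\<lambda>a b. {a, b} \<in> edges t - {{u, v}})\<^sup>*\<^sup>* u v"
    unfolding link_def rtranclp_rtrancl_eq by simp
  then obtain xs0 where "rtrancl_path (\<lambda>a b. {a, b} \<in> edges t - {{u, v}}) u xs0 v"
    unfolding rtranclp_eq_rtrancl_path by blast
  then obtain xs where path: "rtrancl_path (\<lambda>a b. {a, b} \<in> edges t - {{u, v}}) u xs v"
    and dist: "distinct (u # xs)"
    by (rule rtrancl_path_distinct)
  have succ: "successively (\<lambda>a b. {a, b} \<in> edges t - {{u, v}}) (u # xs)" and last: "last (u # xs) = v"
    using rtrancl_path_successively[OF path] by auto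
  have "u \<noteq> v" using card2[OF uv] by auto
  with last succ have "3 \<le> length (u # xs)"
    by (cases xs; cases "tl xs") auto
  moreover have "successively (\<lambda>a b. {a, b} \<in> edges t) (u # xs)"
    using succ by (rule successively_mono) simp
  ultimately have "cycle t (u # xs)"
    using dist last uv by (simp add: cycle_def insert_commute)
  with acyc show False by blast
next
  assume bridges: "\<forall>u v. {u, v} \<in> edges t \<longrightarrow> (u, v) \<notin> (link (edges t - {{u, v}}))\<^sup>*"
  assume "\<exists>vs. cycle t vs"
  then obtain vs where len: "3 \<le> length vs" and dist: "distinct vs"
    and succ: "successively (\<lambda>u v. {u, v} \<in> edges t) vs" and close: "{last vs, hd vs} \<in> edges t"
    by (auto simp: cycle_def)
  let ?n = "length vs"
  have "vs \<noteq> []" using len by auto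
  then have ends: "hd vs = vs ! 0" "last vs = vs ! (?n - 1)"
    by (simp_all add: hd_conv_nth last_conv_nth)
  have "(vs ! 0, vs ! i) \<in> (link (edges t - {{last vs, hd vs}}))\<^sup>*" if "i < ?n" for i
    using that
  proof (induction i)
    case (Suc i)
    have "{vs ! i, vs ! Suc i} \<in> edges t"
      using succ Suc.prems by (simp add: successively_conv_nth)
    moreover have "{vs ! i, vs ! Suc i} \<noteq> {last vs, hd vs}"
    proof
      assume "{vs ! i, vs ! Suc i} = {last vs, hd vs}"
      then consider "vs ! Suc i = vs ! 0" | "vs ! i = vs ! 0" "vs ! Suc i = vs ! (?n - 1)"
        unfolding ends doubleton_eq_iff by blast
      then show False
      proof cases
        case 1
        have "0 < ?n" using len by linarith
        with 1 Suc.prems nth_eq_iff_index_eq[OF dist, of "Suc i" 0] show False by blast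
      next
        case 2
        have "i = 0"
          using 2(1) Suc.prems nth_eq_iff_index_eq[OF dist, of i 0] len by linarith
        moreover have "Suc i = ?n - 1"
          using 2(2) Suc.prems nth_eq_iff_index_eq[OF dist, of "Suc i" "?n - 1"] len by linarith
        ultimately show False using len by linarith
      qed
    qed
    ultimately have "(vs ! i, vs ! Suc i) \<in> link (edges t - {{last vs, hd vs}})"
      by (simp add: link_def)
    with Suc show ?case by (simp add: rtrancl_into_rtrancl)
  qed simp
  from this[of "?n - 1"] \<open>vs \<noteq> []\<close> have "(hd vs, last vs) \<in> (link (edges t - {{last vs, hd vs}}))\<^sup>*"
    by (simp add: ends)
  then have "(last vs, hd vs) \<in> (link (edges t - {{last vs, hd vs}}))\<^sup>*"
    by (rule reach_sym)
  with bridges close show False by blast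
qed

lemma rooted_treeI:
  assumes "finite (verts t)" "root t \<in> verts t"
    and edges: "\<And>e. e \<in> edges t \<Longrightarrow> e \<subseteq> verts t \<and> card e = 2"
    and reach: "\<And>v. v \<in> verts t \<Longrightarrow> (root t, v) \<in> (link (edges t))\<^sup>*"
    and bridges: "\<And>u v. {u, v} \<in> edges t \<Longrightarrow> (u, v) \<notin> (link (edges t - {{u, v}}))\<^sup>*"
  shows "rooted_tree t"
proof -
  have "(u, v) \<in> (adj t)\<^sup>*" if "u \<in> verts t" "v \<in> verts t" for u v
    using rtrancl_trans[OF reach_sym[OF reach[OF that(1)]] reach[OF that(2)]]
    by (simp add: adj_eq_link)
  then show ?thesis
    using assms acyclic_iff_bridges[of t] by (simp add: rooted_tree_def)
qed

lemma rooted_treeD: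
  assumes "rooted_tree t"
  shows "finite (verts t)" "root t \<in> verts t"
    and "e \<in> edges t \<Longrightarrow> e \<subseteq> verts t"
    and "e \<in> edges t \<Longrightarrow> card e = 2"
    and "v \<in> verts t \<Longrightarrow> (root t, v) \<in> (link (edges t))\<^sup>*"
    and "{u, v} \<in> edges t \<Longrightarrow> (u, v) \<notin> (link (edges t - {{u, v}}))\<^sup>*"
  using assms acyclic_iff_bridges[of t] by (auto simp: rooted_tree_def adj_eq_link)

lemma rooted_tree_edgeE:
  assumes "rooted_tree t" "e \<in> edges t"
  obtains u v where "e = {u, v}" "u \<noteq> v" "u \<in> verts t" "v \<in> verts t"
proof -
  obtain u v where "e = {u, v}" "u \<noteq> v"
    using rooted_treeD(4)[OF assms] by (auto simp: card_2_iff)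
  with that rooted_treeD(3)[OF assms] show ?thesis by auto
qed

lemma finite_edges: "rooted_tree t \<Longrightarrow> finite (edges t)"
  by (rule finite_subset[of _ "Pow (verts t)"]) (auto dest: rooted_treeD)

section \<open>Relabelling vertices\<close>

text \<open>Among rooted trees an isomorphism \<open>s \<simeq> t\<close> is the same as an equation \<open>t = map_graph f s\<close> with \<open>f\<close>
  injective on the vertices. Invariance under isomorphism then becomes commutation with
  \<open>map_graph f\<close>.\<close>

definition map_graph :: "('a \<Rightarrow> 'b) \<Rightarrow> 'a rgraph \<Rightarrow> 'b rgraph" where
  "map_graph f t = \<lparr>verts = f ` verts t, edges = (`) f ` edges t, root = f (root t)\<rparr>"

lemma map_graph_simps [simp]:
  "verts (map_graph f t) = f ` verts t"
  "edges (map_graph f t) = (`) f ` edges t"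
  "root (map_graph f t) = f (root t)"
  by (simp_all add: map_graph_def)

lemma rooted_iso_iff_map_graph:
  assumes s: "rooted_tree s" and t: "rooted_tree t"
  shows "s \<simeq> t \<longleftrightarrow> (\<exists>f. inj_on f (verts s) \<and> t = map_graph f s)"
proof
  assume "s \<simeq> t"
  then obtain f where f: "bij_betw f (verts s) (verts t)" "f (root s) = root t"
    and e: "\<And>u v. u \<in> verts s \<Longrightarrow> v \<in> verts s \<Longrightarrow> {u, v} \<in> edges s \<longleftrightarrow> {f u, f v} \<in> edges t"
    unfolding rooted_iso_def by blast
  have im: "f ` verts s = verts t" and inj: "inj_on f (verts s)"
    using f(1) by (auto simp: bij_betw_def)
  have "g \<in> (`) f ` edges s" if g: "g \<in> edges t" for g
  proof -
    obtain a b where ab: "g = {a, b}" "a \<in> verts t" "b \<in> verts t"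
      using rooted_tree_edgeE[OF t g] by metis
    then obtain u v where uv: "a = f u" "b = f v" "u \<in> verts s" "v \<in> verts s"
      using im by blast
    then have "{u, v} \<in> edges s" using e g ab by blast
    moreover have "g = f ` {u, v}" using ab uv by simp
    ultimately show ?thesis by blast
  qed
  moreover have "f ` g \<in> edges t" if g: "g \<in> edges s" for g
  proof -
    obtain a b where "g = {a, b}" "a \<in> verts s" "b \<in> verts s"
      using rooted_tree_edgeE[OF s g] by metis
    with e g show ?thesis by simp
  qed
  ultimately have "edges t = (`) f ` edges s" by blast
  with im inj f(2) show "\<exists>f. inj_on f (verts s) \<and> t = map_graph f s"
    by (intro exI[of _ f]) (simp add: map_graph_def)
next
  assume "\<exists>f. inj_on f (verts s) \<and> t = map_graph f s"
  then obtain f where inj: "inj_on f (verts s)" and t_eq: "t = map_graph f s" by blast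
  have "{u, v} \<in> edges s" if uv: "u \<in> verts s" "v \<in> verts s" and "{f u, f v} \<in> edges t" for u v
  proof -
    from that(3) t_eq obtain g where g: "g \<in> edges s" "f ` {u, v} = f ` g" by auto
    have "{u, v} = g"
      using inj_on_image_eq_iff[OF inj, of "{u, v}" g] g uv rooted_treeD(3)[OF s g(1)] by simp
    with g show ?thesis by simp
  qed
  moreover have "{f u, f v} \<in> edges t" if "{u, v} \<in> edges s" for u v
    using imageI[OF that, of "(`) f"] by (simp add: t_eq)
  ultimately show "s \<simeq> t"
    unfolding rooted_iso_def using inj
    by (intro exI[of _ f]) (auto simp: t_eq bij_betw_def)
qed

lemma image_doubletonE:
  assumes "{p, q} = f ` g"
  obtains a b where "p = f a" "q = f b" "a \<in> g" "b \<in> g"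
  using assms by (metis imageE insertI1 insertI2)

lemma inj_image_doubletonE:
  assumes "{p, q} = f ` g" "inj_on f g"
  obtains a b where "p = f a" "q = f b" "g = {a, b}"
proof -
  obtain a b where ab: "p = f a" "q = f b" "a \<in> g" "b \<in> g"
    using assms(1) by (rule image_doubletonE)
  then have "{a, b} = g"
    using inj_on_image_eq_iff[OF assms(2), of "{a, b}" g] assms(1) by simp
  with ab that show ?thesis by blast
qed

lemma reach_inv_image:
  assumes inj: "inj_on f V" and E: "\<And>e. e \<in> E \<Longrightarrow> e \<subseteq> V"
    and uv: "u \<in> V" "v \<in> V" and "(f u, f v) \<in> (link ((`) f ` E))\<^sup>*"
  shows "(u, v) \<in> (link E)\<^sup>*"
proof -
  have "(inv_into V f (f u), inv_into V f (f v)) \<in> (link E)\<^sup>*"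
  proof (rule reach_map[OF assms(5)])
    fix p q assume "{p, q} \<in> (`) f ` E"
    then obtain g where g: "g \<in> E" "{p, q} = f ` g" by blast
    from g(2) inj_on_subset[OF inj E[OF g(1)]]
    obtain a b where ab: "p = f a" "q = f b" "g = {a, b}" by (rule inj_image_doubletonE)
    with g(1) have "(a, b) \<in> (link E)\<^sup>*" by (simp add: reach_edge)
    then show "(inv_into V f p, inv_into V f q) \<in> (link E)\<^sup>*"
      using ab E[OF g(1)] inj by (auto simp: inv_into_f_f subset_iff)
  qed
  then show ?thesis using inj uv by (simp add: inv_into_f_f)
qed

lemma image_edges_minus:
  assumes "inj_on f V" "\<And>g. g \<in> E \<Longrightarrow> g \<subseteq> V" "e \<in> E"
  shows "(`) f ` E - {f ` e} = (`) f ` (E - {e})"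
  using assms by (auto simp: inj_on_image_eq_iff)

lemma rooted_tree_map_graph:
  assumes t: "rooted_tree t" and inj: "inj_on f (verts t)"
  shows "rooted_tree (map_graph f t)"
proof (rule rooted_treeI)
  show "finite (verts (map_graph f t))" "root (map_graph f t) \<in> verts (map_graph f t)"
    using rooted_treeD(1,2)[OF t] by auto
  show "e \<subseteq> verts (map_graph f t) \<and> card e = 2" if "e \<in> edges (map_graph f t)" for e
    using that rooted_treeD(3,4)[OF t] by (auto simp: card_image inj_on_subset[OF inj])
next
  fix v assume "v \<in> verts (map_graph f t)"
  then obtain x where x: "x \<in> verts t" "v = f x" by auto
  have "(f (root t), f x) \<in> (link ((`) f ` edges t))\<^sup>*"
  proof (rule reach_map[OF rooted_treeD(5)[OF t x(1)]])
    fix a b assume "{a, b} \<in> edges t"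
    from imageI[OF this, of "(`) f"] show "(f a, f b) \<in> (link ((`) f ` edges t))\<^sup>*"
      by (intro reach_edge) simp
  qed
  then show "(root (map_graph f t), v) \<in> (link (edges (map_graph f t)))\<^sup>*"
    using x by simp
next
  fix p q assume "{p, q} \<in> edges (map_graph f t)"
  then obtain g where g: "g \<in> edges t" "{p, q} = f ` g" by auto
  have gV: "g \<subseteq> verts t" using rooted_treeD(3)[OF t g(1)] .
  from g(2) inj_on_subset[OF inj gV]
  obtain a b where ab: "p = f a" "q = f b" "g = {a, b}" by (rule inj_image_doubletonE)
  show "(p, q) \<notin> (link (edges (map_graph f t) - {{p, q}}))\<^sup>*"
  proof
    assume "(p, q) \<in> (link (edges (map_graph f t) - {{p, q}}))\<^sup>*"
    then have "(f a, f b) \<in> (link ((`) f ` (edges t - {g})))\<^sup>*"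
      using image_edges_minus[OF inj rooted_treeD(3)[OF t] g(1)] g(2) ab(1,2) by simp
    then have "(a, b) \<in> (link (edges t - {g}))\<^sup>*"
      by (rule reach_inv_image[OF inj, rotated 3]) (use ab gV rooted_treeD(3)[OF t] in auto)
    with rooted_treeD(6)[OF t] g(1) ab(3) show False by blast
  qed
qed

section \<open>Cutting a tree at an edge\<close>

lemma mem_root_part: "v \<in> root_part t e \<longleftrightarrow> v \<in> verts t \<and> (root t, v) \<in> (link (edges t - {e}))\<^sup>*"
  by (simp add: root_part_def adj_eq_link)

lemma root_in_root_part: "rooted_tree t \<Longrightarrow> root t \<in> root_part t e"
  by (simp add: mem_root_part rooted_treeD(2))

lemma root_part_closed:
  assumes "rooted_tree t" "{a, b} \<in> edges t" "{a, b} \<noteq> e" "a \<in> root_part t e"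
  shows "b \<in> root_part t e"
proof -
  have "(root t, b) \<in> (link (edges t - {e}))\<^sup>*"
  proof (rule rtrancl_into_rtrancl)
    show "(root t, a) \<in> (link (edges t - {e}))\<^sup>*" "(a, b) \<in> link (edges t - {e})"
      using assms(2-4) by (simp_all add: mem_root_part link_def)
  qed
  then show ?thesis
    using rooted_treeD(3)[OF assms(1,2)] by (simp add: mem_root_part)
qed

text \<open>If both ends of \<open>e\<close> lay on the side of the root, \<open>e\<close> would not be a bridge; if none did, that side
  could not be left along any edge, and the tree would not be connected.\<close>

lemma root_part_endpoints:
  assumes t: "rooted_tree t" and e: "e \<in> edges t"
  obtains u v where "e = {u, v}" "u \<in> root_part t e" "v \<in> verts t" "v \<notin> root_part t e"
proof -
  let ?A = "root_part t e"
  obtain a b where ab: "e = {a, b}" "a \<in> verts t" "b \<in> verts t"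
    using rooted_tree_edgeE[OF t e] by metis
  have "\<not> (a \<in> ?A \<and> b \<in> ?A)"
  proof
    assume "a \<in> ?A \<and> b \<in> ?A"
    then have "(a, b) \<in> (link (edges t - {e}))\<^sup>*"
      using rtrancl_trans[OF reach_sym] by (auto simp: mem_root_part)
    with rooted_treeD(6)[OF t] e ab(1) show False by blast
  qed
  moreover have "a \<in> ?A \<or> b \<in> ?A"
  proof (rule ccontr)
    assume no: "\<not> (a \<in> ?A \<or> b \<in> ?A)"
    have "a \<in> ?A"
    proof (rule reach_closed[OF rooted_treeD(5)[OF t ab(2)]])
      fix x y assume xy: "{x, y} \<in> edges t" "x \<in> ?A"
      with no ab(1) have "{x, y} \<noteq> e" by (auto simp: doubleton_eq_iff)
      with root_part_closed[OF t xy(1) _ xy(2)] show "y \<in> ?A" .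
    qed (rule root_in_root_part[OF t])
    with no show False by blast
  qed
  ultimately consider "a \<in> ?A" "b \<notin> ?A" | "b \<in> ?A" "a \<notin> ?A" by blast
  then show ?thesis
  proof cases
    case 1
    with ab show ?thesis by (intro that)
  next
    case 2
    have "e = {b, a}" using ab(1) by (rule trans) (rule insert_commute)
    with 2 ab show ?thesis by (intro that)
  qed
qed

lemma edge_in_part:
  assumes t: "rooted_tree t" and g: "g \<in> edges t" "g \<noteq> e"
  shows "g \<subseteq> root_part t e \<or> g \<subseteq> verts t - root_part t e"
proof -
  obtain a b where ab: "g = {a, b}" "a \<in> verts t" "b \<in> verts t"
    using rooted_tree_edgeE[OF t g(1)] by metis
  then have "g = {b, a}" by (simp add: insert_commute)
  with ab g have "a \<in> root_part t e \<longleftrightarrow> b \<in> root_part t e"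
    using root_part_closed[OF t, of a b e] root_part_closed[OF t, of b a e] by metis
  with ab show ?thesis by simp
qed

lemma arg_min_on_unique:
  assumes "a \<in> W" "\<And>x. x \<in> W \<Longrightarrow> x \<noteq> a \<Longrightarrow> f a < (f x :: nat)"
  shows "arg_min_on f W = a"
  unfolding arg_min_on_def arg_min_def is_arg_min_def
proof (rule some_equality)
  show "a \<in> W \<and> (\<nexists>y. y \<in> W \<and> f y < f a)"
    using assms by (metis order_less_asym order_less_irrefl)
  show "x = a" if "x \<in> W \<and> (\<nexists>y. y \<in> W \<and> f y < f x)" for x
    using assms that by blast
qed

text \<open>Used when every walk to \<open>x\<close> passes \<open>w\<close> earlier.\<close>

lemma tree_dist_less:
  assumes "(u, x) \<in> (link (edges t))\<^sup>*"
    and "\<And>n. (u, x) \<in> link (edges t) ^^ n \<Longrightarrow> \<exists>m<n. (u, w) \<in> link (edges t) ^^ m"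
  shows "tree_dist t u w < tree_dist t u x"
proof -
  obtain n where "(u, x) \<in> link (edges t) ^^ n"
    using assms(1) rtrancl_power by blast
  then have "(u, x) \<in> link (edges t) ^^ tree_dist t u x"
    unfolding tree_dist_def adj_eq_link by (rule LeastI)
  then obtain m where m: "m < tree_dist t u x" "(u, w) \<in> link (edges t) ^^ m"
    using assms(2) by blast
  have "tree_dist t u w \<le> m"
    unfolding tree_dist_def adj_eq_link using m(2) by (rule Least_le)
  with m(1) show ?thesis by simp
qed

lemma R_part_eq:
  assumes t: "rooted_tree t"
  shows "R_part e t = \<lparr>verts = root_part t e, edges = {g \<in> edges t. g \<subseteq> root_part t e}, root = root t\<rparr>"
proof -
  have "arg_min_on (tree_dist t (root t)) (root_part t e) = root t"
  proof (rule arg_min_on_unique)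
    fix x assume x: "x \<in> root_part t e" "x \<noteq> root t"
    show "tree_dist t (root t) (root t) < tree_dist t (root t) x"
    proof (rule tree_dist_less)
      show "(root t, x) \<in> (link (edges t))\<^sup>*"
        using x rooted_treeD(5)[OF t] by (simp add: mem_root_part)
      fix n assume "(root t, x) \<in> link (edges t) ^^ n"
      with x(2) have "0 < n" by (cases n) simp_all
      then show "\<exists>m<n. (root t, root t) \<in> link (edges t) ^^ m"
        by (intro exI[of _ 0]) simp
    qed
  qed (rule root_in_root_part[OF t])
  then show ?thesis
    by (simp add: R_part_def subtree_on_def)
qed

text \<open>The far part can be entered only through \<open>e\<close>, hence only at the far end \<open>v\<close> of \<open>e\<close>, and so \<open>v\<close> is its
  single vertex closest to the root.\<close>

lemma P_part_eq:
  assumes t: "rooted_tree t" and e: "e \<in> edges t" and v: "v \<in> e" "v \<notin> root_part t e"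
  shows "P_part e t = \<lparr>verts = verts t - root_part t e,
    edges = {g \<in> edges t. g \<subseteq> verts t - root_part t e}, root = v\<rparr>"
proof -
  let ?A = "root_part t e"
  have vV: "v \<in> verts t" using rooted_treeD(3)[OF t e] v by auto
  have cross: "y = v" if yz: "{y, z} \<in> edges t" "z \<in> ?A" "y \<notin> ?A" for y z
  proof -
    have "{y, z} = e"
      using root_part_closed[OF t _ _ yz(2), of y] yz by (auto simp: insert_commute)
    with v yz(2) show ?thesis by auto
  qed
  have passes: "\<exists>m<n. (root t, v) \<in> link (edges t) ^^ m"
    if "(root t, x) \<in> link (edges t) ^^ n" "x \<notin> ?A" "x \<noteq> v" for n x
    using that
  proof (induction n arbitrary: x)
    case 0
    with root_in_root_part[OF t, of e] show ?case by auto
  next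
    case (Suc n)
    then obtain y where y: "(root t, y) \<in> link (edges t) ^^ n" "{y, x} \<in> edges t"
      by (auto simp: link_def)
    have "y \<notin> ?A"
      using cross[of x y] y(2) Suc.prems by (auto simp: insert_commute)
    then show ?case
      using Suc.IH[OF y(1)] y(1) by (cases "y = v") (blast intro: less_SucI lessI)+
  qed
  have "arg_min_on (tree_dist t (root t)) (verts t - ?A) = v"
  proof (rule arg_min_on_unique)
    fix x assume x: "x \<in> verts t - ?A" "x \<noteq> v"
    show "tree_dist t (root t) v < tree_dist t (root t) x"
    proof (rule tree_dist_less)
      show "(root t, x) \<in> (link (edges t))\<^sup>*"
        using x rooted_treeD(5)[OF t] by blast
      fix n assume "(root t, x) \<in> link (edges t) ^^ n"
      with x show "\<exists>m<n. (root t, v) \<in> link (edges t) ^^ m"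
        using passes[of x n] by simp
    qed
  qed (use vV v in auto)
  then show ?thesis
    by (simp add: P_part_def subtree_on_def)
qed

lemma rooted_tree_induced:
  assumes t: "rooted_tree t" and W: "W \<subseteq> verts t" "r \<in> W"
    and reach: "\<And>x. x \<in> W \<Longrightarrow> (r, x) \<in> (link {g \<in> edges t. g \<subseteq> W})\<^sup>*"
  shows "rooted_tree \<lparr>verts = W, edges = {g \<in> edges t. g \<subseteq> W}, root = r\<rparr>" (is "rooted_tree ?s")
proof (rule rooted_treeI)
  show "finite (verts ?s)"
    using finite_subset[OF W(1)] rooted_treeD(1)[OF t] by simp
  fix u v assume uv: "{u, v} \<in> edges ?s"
  show "(u, v) \<notin> (link (edges ?s - {{u, v}}))\<^sup>*"
  proof
    assume "(u, v) \<in> (link (edges ?s - {{u, v}}))\<^sup>*"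
    then have "(u, v) \<in> (link (edges t - {{u, v}}))\<^sup>*"
      by (rule reach_mono) auto
    with rooted_treeD(6)[OF t] uv show False by simp
  qed
qed (use W reach rooted_treeD(4)[OF t] in auto)

lemma rooted_tree_R_part:
  assumes t: "rooted_tree t"
  shows "rooted_tree (R_part e t)"
  unfolding R_part_eq[OF t]
proof (rule rooted_tree_induced[OF t])
  let ?A = "root_part t e"
  show "?A \<subseteq> verts t" by (auto simp: mem_root_part)
  show "root t \<in> ?A" by (rule root_in_root_part[OF t])
  fix x assume "x \<in> ?A"
  then have "(root t, x) \<in> (link (edges t - {e}))\<^sup>*" by (simp add: mem_root_part)
  then have "x \<in> ?A \<and> (root t, x) \<in> (link {g \<in> edges t. g \<subseteq> ?A})\<^sup>*"
  proof (induction rule: rtrancl_induct)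
    case base
    then show ?case by (simp add: root_in_root_part[OF t])
  next
    case (step y z)
    then have yz: "{y, z} \<in> edges t" "{y, z} \<noteq> e" by (auto simp: link_def)
    from root_part_closed[OF t yz] step.IH have z: "z \<in> ?A" by blast
    with step.IH yz have "(y, z) \<in> link {g \<in> edges t. g \<subseteq> ?A}" by (simp add: link_def)
    with step.IH z show ?case by (meson rtrancl_into_rtrancl)
  qed
  then show "(root t, x) \<in> (link {g \<in> edges t. g \<subseteq> ?A})\<^sup>*" by blast
qed

lemma rooted_tree_P_part:
  assumes t: "rooted_tree t" and e: "e \<in> edges t"
  shows "rooted_tree (P_part e t)"
proof -
  let ?A = "root_part t e"
  let ?B = "verts t - ?A"
  obtain u v where uv: "e = {u, v}" "u \<in> ?A" "v \<in> verts t" "v \<notin> ?A"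
    by (rule root_part_endpoints[OF t e])
  have "v \<in> e" using uv(1) by simp
  show ?thesis
    unfolding P_part_eq[OF t e \<open>v \<in> e\<close> uv(4)]
  proof (rule rooted_tree_induced[OF t])
    fix x assume x: "x \<in> ?B"
    then have "(root t, x) \<in> (link (edges t))\<^sup>*" using rooted_treeD(5)[OF t] by blast
    then have "x \<in> ?A \<or> (v, x) \<in> (link {g \<in> edges t. g \<subseteq> ?B})\<^sup>*"
    proof (induction rule: rtrancl_induct)
      case base
      then show ?case by (simp add: root_in_root_part[OF t])
    next
      case (step y z)
      then have yz: "{y, z} \<in> edges t" by (simp add: link_def)
      show ?case
      proof (cases "{y, z} = e")
        case True
        then show ?thesis using uv(1,2) by (auto simp: doubleton_eq_iff)
      next
        case False
        from edge_in_part[OF t yz False] consider "z \<in> ?A" | "{y, z} \<subseteq> ?B"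
          by blast
        then show ?thesis
        proof cases
          case 2
          with yz have "(y, z) \<in> link {g \<in> edges t. g \<subseteq> ?B}" by (simp add: link_def)
          moreover have "(v, y) \<in> (link {g \<in> edges t. g \<subseteq> ?B})\<^sup>*"
            using step.IH 2 by blast
          ultimately have "(v, z) \<in> (link {g \<in> edges t. g \<subseteq> ?B})\<^sup>*"
            by (simp only: rtrancl.rtrancl_into_rtrancl)
          then show ?thesis ..
        qed simp
      qed
    qed
    with x show "(v, x) \<in> (link {g \<in> edges t. g \<subseteq> ?B})\<^sup>*" by blast
  qed (use uv in auto)
qed

lemma graft_simps [simp]:
  "verts (graft s v t) = Inl ` verts s \<union> Inr ` verts t"
  "edges (graft s v t) = insert {Inl v, Inr (root t)} ((`) Inl ` edges s \<union> (`) Inr ` edges t)"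
  "root (graft s v t) = Inl (root s)"
  by (auto simp: graft_def Plus_def)

text \<open>A tree is recovered from its two parts by grafting the far part at the near end of the removed
  edge; the new edge of the graft becomes the removed one.\<close>

lemma graft_parts:
  assumes t: "rooted_tree t" and e: "e = {u, v}" "e \<in> edges t" "u \<in> root_part t e" "v \<notin> root_part t e"
  defines "h \<equiv> case_sum id id"
  shows "map_graph h (graft (R_part e t) u (P_part e t)) = t" (is ?eq)
    and "inj_on h (verts (graft (R_part e t) u (P_part e t)))" (is ?inj)
    and "h ` {Inl u, Inr (root (P_part e t))} = e" (is ?e)
proof -
  let ?A = "root_part t e"
  have "v \<in> e" using e by simp
  note P = P_part_eq[OF t e(2) this e(4)]
  have A: "?A \<subseteq> verts t" by (auto simp: mem_root_part)
  have "edges t = insert e ({g \<in> edges t. g \<subseteq> ?A} \<union> {g \<in> edges t. g \<subseteq> verts t - ?A})"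
    using edge_in_part[OF t, of _ e] e(2) by blast
  then show ?eq
    using A by (intro rgraph.equality)
      (simp_all add: P R_part_eq[OF t] h_def image_image image_Un Un_absorb1 flip: e(1))
  show ?inj
    by (auto simp: inj_on_def h_def P R_part_eq[OF t])
  show ?e
  proof -
    have "root (P_part e t) = v" by (simp add: P)
    then show ?thesis by (simp add: h_def e(1))
  qed
qed

lemma root_part_map_graph:
  assumes t: "rooted_tree t" and inj: "inj_on f (verts t)" and e: "e \<in> edges t"
  shows "root_part (map_graph f t) (f ` e) = f ` root_part t e"
proof -
  note m = image_edges_minus[OF inj rooted_treeD(3)[OF t] e, simplified]
  have "(f (root t), f x) \<in> (link ((`) f ` (edges t - {e})))\<^sup>* \<longleftrightarrow> (root t, x) \<in> (link (edges t - {e}))\<^sup>*"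
    if x: "x \<in> verts t" for x
  proof
    assume "(f (root t), f x) \<in> (link ((`) f ` (edges t - {e})))\<^sup>*"
    then show "(root t, x) \<in> (link (edges t - {e}))\<^sup>*"
      by (rule reach_inv_image[OF inj, rotated 3]) (use x rooted_treeD(2,3)[OF t] in auto)
  next
    assume "(root t, x) \<in> (link (edges t - {e}))\<^sup>*"
    then show "(f (root t), f x) \<in> (link ((`) f ` (edges t - {e})))\<^sup>*"
    proof (rule reach_map)
      fix a b assume "{a, b} \<in> edges t - {e}"
      from imageI[OF this, of "(`) f"] show "(f a, f b) \<in> (link ((`) f ` (edges t - {e})))\<^sup>*"
        by (intro reach_edge) simp
    qed
  qed
  then show ?thesis
    by (auto simp: mem_root_part m)
qed

lemma induced_edges_image:
  assumes "inj_on f V" "W \<subseteq> V" "\<And>g. g \<in> E \<Longrightarrow> g \<subseteq> V"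
  shows "{g \<in> (`) f ` E. g \<subseteq> f ` W} = (`) f ` {g \<in> E. g \<subseteq> W}"
proof -
  have "g \<subseteq> W" if "g \<in> E" "f ` g \<subseteq> f ` W" for g
    using that assms(3)[OF that(1)] inj_on_image_mem_iff[OF assms(1) _ assms(2)] by blast
  then show ?thesis by blast
qed

lemma R_part_map_graph:
  assumes t: "rooted_tree t" and inj: "inj_on f (verts t)" and e: "e \<in> edges t"
  shows "R_part (f ` e) (map_graph f t) = map_graph f (R_part e t)"
proof -
  have "root_part t e \<subseteq> verts t" by (auto simp: mem_root_part)
  then show ?thesis
    using induced_edges_image[OF inj _ rooted_treeD(3)[OF t]]
    unfolding R_part_eq[OF t] R_part_eq[OF rooted_tree_map_graph[OF t inj]]
    by (simp add: map_graph_def root_part_map_graph[OF t inj e, unfolded map_graph_def])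
qed

lemma P_part_map_graph:
  assumes t: "rooted_tree t" and inj: "inj_on f (verts t)" and e: "e \<in> edges t"
  shows "P_part (f ` e) (map_graph f t) = map_graph f (P_part e t)"
proof -
  obtain u v where uv: "e = {u, v}" "u \<in> root_part t e" "v \<in> verts t" "v \<notin> root_part t e"
    by (rule root_part_endpoints[OF t e])
  have A: "root_part t e \<subseteq> verts t" by (auto simp: mem_root_part)
  have v: "v \<in> e" "f v \<in> f ` e" using uv(1) by auto
  have fe: "f ` e \<in> edges (map_graph f t)" using e by simp
  have fv: "f v \<notin> root_part (map_graph f t) (f ` e)"
    using inj uv(3,4) A by (simp add: root_part_map_graph[OF t inj e] inj_on_image_mem_iff)
  have diff: "f ` verts t - f ` root_part t e = f ` (verts t - root_part t e)"
    using A by (intro inj_on_image_set_diff[OF inj, symmetric]) auto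
  show ?thesis
    using induced_edges_image[OF inj Diff_subset rooted_treeD(3)[OF t], of "edges t"]
    unfolding P_part_eq[OF t e v(1) uv(4)] P_part_eq[OF rooted_tree_map_graph[OF t inj] fe v(2) fv]
    by (simp add: map_graph_def root_part_map_graph[OF t inj e, unfolded map_graph_def] diff)
qed

section \<open>Grafting\<close>

text \<open>Without the new edge, no edge joins the two summands of the vertex set.\<close>

lemma new_edge_separates:
  assumes "(x, y) \<in> (link (edges (graft s v t) - {{Inl v, Inr (root t)}}))\<^sup>*"
  shows "isl x = isl y"
proof -
  have "(isl x, isl y) \<in> (link {})\<^sup>*"
  proof (rule reach_map[OF assms, where h = isl])
    fix a b assume "{a, b} \<in> edges (graft s v t) - {{Inl v, Inr (root t)}}"
    then consider g where "{a, b} = Inl ` g" | g where "{a, b} = Inr ` g" by auto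
    then show "(isl a, isl b) \<in> (link {})\<^sup>*"
      by cases (auto elim!: image_doubletonE)
  qed
  then show ?thesis by (simp add: link_def)
qed

text \<open>Every edge of the graft is a bridge. For an edge of one of the pieces, collapse the other piece to
  the vertex where the two are joined: a walk that avoids the edge is sent to such a walk in
  the piece. For the new edge, the two pieces are disconnected without it.\<close>

lemma rooted_tree_graft:
  assumes s: "rooted_tree s" and t: "rooted_tree t" and v: "v \<in> verts s"
  shows "rooted_tree (graft s v t)"
proof (rule rooted_treeI)
  show "finite (verts (graft s v t))" "root (graft s v t) \<in> verts (graft s v t)"
    using rooted_treeD(1,2)[OF s] rooted_treeD(1)[OF t] by auto
  show "e \<subseteq> verts (graft s v t) \<and> card e = 2" if "e \<in> edges (graft s v t)" for e
    using that v rooted_treeD(4)[OF s] rooted_treeD(2,4)[OF t]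
    by (auto simp: card_image intro: subsetD[OF rooted_treeD(3)[OF s]] subsetD[OF rooted_treeD(3)[OF t]])
next
  let ?E = "edges (graft s v t)"
  have Inl: "(Inl a, Inl b) \<in> (link ?E)\<^sup>*" if "(a, b) \<in> (link (edges s))\<^sup>*" for a b
  proof (rule reach_map[OF that])
    fix a b assume "{a, b} \<in> edges s"
    then have "Inl ` {a, b} \<in> ?E" unfolding graft_simps by blast
    then show "(Inl a, Inl b) \<in> (link ?E)\<^sup>*"
      by (simp only: image_insert image_empty reach_edge)
  qed
  have Inr: "(Inr a, Inr b) \<in> (link ?E)\<^sup>*" if "(a, b) \<in> (link (edges t))\<^sup>*" for a b
  proof (rule reach_map[OF that])
    fix a b assume "{a, b} \<in> edges t"
    then have "Inr ` {a, b} \<in> ?E" unfolding graft_simps by blast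
    then show "(Inr a, Inr b) \<in> (link ?E)\<^sup>*"
      by (simp only: image_insert image_empty reach_edge)
  qed
  have new: "(Inl v, Inr (root t)) \<in> (link ?E)\<^sup>*" by (intro reach_edge) simp
  fix x assume "x \<in> verts (graft s v t)"
  then consider a where "a \<in> verts s" "x = Inl a" | b where "b \<in> verts t" "x = Inr b" by auto
  then show "(root (graft s v t), x) \<in> (link ?E)\<^sup>*"
  proof cases
    case 1
    then show ?thesis using Inl rooted_treeD(5)[OF s] by simp
  next
    case 2
    have "(Inl (root s), Inl v) \<in> (link ?E)\<^sup>*" using Inl rooted_treeD(5)[OF s v] by simp
    also note new
    also have "(Inr (root t), Inr b) \<in> (link ?E)\<^sup>*" using Inr rooted_treeD(5)[OF t 2(1)] by simp
    finally show ?thesis using 2(2) by simp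
  qed
next
  fix p q assume "{p, q} \<in> edges (graft s v t)"
  then consider g where "g \<in> edges s" "{p, q} = Inl ` g" | g where "g \<in> edges t" "{p, q} = Inr ` g"
    | "{p, q} = {Inl v, Inr (root t)}" by auto
  then show "(p, q) \<notin> (link (edges (graft s v t) - {{p, q}}))\<^sup>*"
  proof cases
    case 1
    from 1(2) obtain a b where ab: "p = Inl a" "q = Inl b" and g: "g = {a, b}"
      by (rule inj_image_doubletonE) simp_all
    show ?thesis
    proof
      \<comment> \<open>Collapse \<open>t\<close> to \<open>v\<close>.\<close>
      let ?h = "case_sum id (\<lambda>_. v)"
      assume "(p, q) \<in> (link (edges (graft s v t) - {{p, q}}))\<^sup>*"
      then have "(?h p, ?h q) \<in> (link (edges s - {{a, b}}))\<^sup>*"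
      proof (rule reach_map)
        fix x y assume xy: "{x, y} \<in> edges (graft s v t) - {{p, q}}"
        then consider g' where "g' \<in> edges s" "{x, y} = Inl ` g'" | g' where "{x, y} = Inr ` g'"
          | "{x, y} = {Inl v, Inr (root t)}" by auto
        then show "(?h x, ?h y) \<in> (link (edges s - {{a, b}}))\<^sup>*"
        proof cases
          case 1
          from 1(2) obtain c d where cd: "x = Inl c" "y = Inl d" "g' = {c, d}"
            by (rule inj_image_doubletonE) simp_all
          with 1(1) xy ab cd have "{c, d} \<in> edges s - {{a, b}}" by (auto simp: doubleton_eq_iff)
          with cd show ?thesis by (simp add: reach_edge)
        next
          case 2
          then show ?thesis by (auto elim!: image_doubletonE)
        next
          case 3
          then show ?thesis by (auto simp: doubleton_eq_iff)
        qed
      qed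
      with rooted_treeD(6)[OF s] 1(1) ab g show False by simp
    qed
  next
    case 2
    from 2(2) obtain a b where ab: "p = Inr a" "q = Inr b" and g: "g = {a, b}"
      by (rule inj_image_doubletonE) simp_all
    show ?thesis
    proof
      \<comment> \<open>Collapse \<open>s\<close> to the root of \<open>t\<close>.\<close>
      let ?h = "case_sum (\<lambda>_. root t) id"
      assume "(p, q) \<in> (link (edges (graft s v t) - {{p, q}}))\<^sup>*"
      then have "(?h p, ?h q) \<in> (link (edges t - {{a, b}}))\<^sup>*"
      proof (rule reach_map)
        fix x y assume xy: "{x, y} \<in> edges (graft s v t) - {{p, q}}"
        then consider g' where "g' \<in> edges t" "{x, y} = Inr ` g'" | g' where "{x, y} = Inl ` g'"
          | "{x, y} = {Inl v, Inr (root t)}" by auto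
        then show "(?h x, ?h y) \<in> (link (edges t - {{a, b}}))\<^sup>*"
        proof cases
          case 1
          from 1(2) obtain c d where cd: "x = Inr c" "y = Inr d" "g' = {c, d}"
            by (rule inj_image_doubletonE) simp_all
          with 1(1) xy ab cd have "{c, d} \<in> edges t - {{a, b}}" by (auto simp: doubleton_eq_iff)
          with cd show ?thesis by (simp add: reach_edge)
        next
          case 2
          then show ?thesis by (auto elim!: image_doubletonE)
        next
          case 3
          then show ?thesis by (auto simp: doubleton_eq_iff)
        qed
      qed
      with rooted_treeD(6)[OF t] 2(1) ab g show False by simp
    qed
  next
    case 3
    show ?thesis
    proof
      assume "(p, q) \<in> (link (edges (graft s v t) - {{p, q}}))\<^sup>*"
      then have "isl p = isl q"
        unfolding 3 by (rule new_edge_separates)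
      with 3 show False by (auto simp: doubleton_eq_iff)
    qed
  qed
qed

lemma root_part_graft:
  assumes s: "rooted_tree s" 
  shows "root_part (graft s v t) {Inl v, Inr (root t)} = Inl ` verts s"
proof (intro equalityI subsetI)
  fix x assume "x \<in> root_part (graft s v t) {Inl v, Inr (root t)}"
  then have x: "x \<in> verts (graft s v t)"
    and r: "(root (graft s v t), x) \<in> (link (edges (graft s v t) - {{Inl v, Inr (root t)}}))\<^sup>*"
    by (simp_all add: mem_root_part del: graft_simps)
  from new_edge_separates[OF r] x show "x \<in> Inl ` verts s" by auto
next
  fix x :: "'a + 'b" assume "x \<in> Inl ` verts s"
  then obtain a where a: "a \<in> verts s" "x = Inl a" by blast
  have "(Inl (root s), Inl a) \<in> (link (edges (graft s v t) - {{Inl v, Inr (root t)}}))\<^sup>*"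
  proof (rule reach_map[OF rooted_treeD(5)[OF s a(1)]])
    fix c d assume "{c, d} \<in> edges s"
    then have "Inl ` {c, d} \<in> edges (graft s v t)"
      unfolding graft_simps by blast
    moreover have "Inl ` {c, d} \<noteq> {Inl v, Inr (root t)}"
      by (auto simp: doubleton_eq_iff)
    ultimately have "Inl ` {c, d} \<in> edges (graft s v t) - {{Inl v, Inr (root t)}}"
      by blast
    then show "(Inl c, Inl d) \<in> (link (edges (graft s v t) - {{Inl v, Inr (root t)}}))\<^sup>*"
      by (simp only: image_insert image_empty reach_edge)
  qed
  with a show "x \<in> root_part (graft s v t) {Inl v, Inr (root t)}"
    by (simp add: mem_root_part)
qed

text \<open>The converse of the reassembly of a tree: cutting a graft at its new edge returns the pieces.\<close>

lemma parts_graft: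
  fixes s :: "'a rgraph" and t :: "'b rgraph"
  assumes s: "rooted_tree s" and t: "rooted_tree t" and v: "v \<in> verts s"
  shows "R_part {Inl v, Inr (root t)} (graft s v t) = map_graph Inl s"
    and "P_part {Inl v, Inr (root t)} (graft s v t) = map_graph Inr t"
proof -
  let ?e = "{Inl v, Inr (root t)}"
  note st = rooted_tree_graft[OF s t v]
  have ne: "{} \<notin> edges s" "{} \<notin> edges t"
    using rooted_treeD(4)[OF s, of "{}"] rooted_treeD(4)[OF t, of "{}"] by auto
  have disj: "(Inr ` g :: ('a + 'b) set) \<subseteq> Inl ` A \<longleftrightarrow> g = {}" "(Inl ` g' :: ('a + 'b) set) \<subseteq> Inr ` B \<longleftrightarrow> g' = {}"
    for g g' A B
    by auto
  have "{g \<in> edges (graft s v t). g \<subseteq> Inl ` verts s} = (`) Inl ` edges s"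
    (is "?M = ?N")
  proof
    show "?M \<subseteq> ?N" by (auto simp: disj ne)
    show "?N \<subseteq> ?M" using rooted_treeD(3)[OF s] by (auto intro!: imageI)
  qed
  then show "R_part ?e (graft s v t) = map_graph Inl s"
    unfolding R_part_eq[OF st] root_part_graft[OF s] by (simp add: map_graph_def)
  have rest: "verts (graft s v t) - Inl ` verts s = Inr ` verts t" by auto
  have inner: "{g \<in> edges (graft s v t). g \<subseteq> Inr ` verts t} = (`) Inr ` edges t" (is "?M = ?N")
  proof
    show "?M \<subseteq> ?N" by (auto simp: disj ne)
    show "?N \<subseteq> ?M" using rooted_treeD(3)[OF t] by (auto intro!: imageI)
  qed
  have "?e \<in> edges (graft s v t)" "Inr (root t) \<in> ?e"
    "Inr (root t) \<notin> root_part (graft s v t) ?e"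
    by (auto simp: root_part_graft[OF s])
  note P_part_eq[OF st this]
  then show "P_part ?e (graft s v t) = map_graph Inr t"
    by (simp only: root_part_graft[OF s] rest inner map_graph_def)
qed

lemma map_graph_graft:
  "map_graph (map_sum f g) (graft s v t) = graft (map_graph f s) (f v) (map_graph g t)"
proof -
  have "map_sum f g ` Inl ` A = Inl ` f ` A" "(`) (map_sum f g) ` (`) Inl ` E = (`) Inl ` (`) f ` E"
    for A E by (simp_all only: image_image map_sum.simps)
  moreover have "map_sum f g ` Inr ` A = Inr ` g ` A" "(`) (map_sum f g) ` (`) Inr ` E = (`) Inr ` (`) g ` E"
    for A E by (simp_all only: image_image map_sum.simps)
  ultimately show ?thesis
    unfolding map_graph_def graft_def Plus_def
    by (simp only: image_Un image_insert image_empty map_sum.simps rgraph.simps)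
qed

section \<open>Cutting and grafting up to isomorphism\<close>

lemma same_tree_iff_map_graph:
  "same_tree s t \<longleftrightarrow> rooted_tree s \<and> (\<exists>f. inj_on f (verts s) \<and> t = map_graph f s)"
  unfolding same_tree_def using rooted_iso_iff_map_graph rooted_tree_map_graph by metis

lemma same_tree_map_graph: "rooted_tree t \<Longrightarrow> inj_on f (verts t) \<Longrightarrow> same_tree t (map_graph f t)"
  unfolding same_tree_iff_map_graph by blast

lemma same_treeD: "same_tree s t \<Longrightarrow> rooted_tree s" "same_tree s t \<Longrightarrow> rooted_tree t"
  by (simp_all add: same_tree_def)

lemma same_tree_parts_map:
  assumes "rooted_tree t" "inj_on f (verts t)" "e \<in> edges t"
  shows "same_tree (R_part e t) (R_part (f ` e) (map_graph f t))"
    and "same_tree (P_part e t) (P_part (f ` e) (map_graph f t))"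
proof -
  have sub: "verts (R_part e t) \<subseteq> verts t" "verts (P_part e t) \<subseteq> verts t"
    by (auto simp: R_part_def P_part_def subtree_on_def mem_root_part)
  show "same_tree (R_part e t) (R_part (f ` e) (map_graph f t))"
    unfolding R_part_map_graph[OF assms]
    by (rule same_tree_map_graph[OF rooted_tree_R_part[OF assms(1)] inj_on_subset[OF assms(2) sub(1)]])
  show "same_tree (P_part e t) (P_part (f ` e) (map_graph f t))"
    unfolding P_part_map_graph[OF assms]
    by (rule same_tree_map_graph[OF rooted_tree_P_part[OF assms(1,3)] inj_on_subset[OF assms(2) sub(2)]])
qed

lemma same_tree_parts_graft:
  assumes s: "rooted_tree s" and t: "rooted_tree t" and v: "v \<in> verts s"
  shows "same_tree s (R_part {Inl v, Inr (root t)} (graft s v t))"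
    and "same_tree t (P_part {Inl v, Inr (root t)} (graft s v t))"
  unfolding parts_graft[OF assms] by (auto intro!: same_tree_map_graph s t)

lemma inj_on_map_sum_graft:
  assumes "inj_on f (verts s)" "inj_on g (verts t)"
  shows "inj_on (map_sum f g) (verts (graft s v t))"
proof (rule inj_onI)
  fix x y assume "x \<in> verts (graft s v t)" "y \<in> verts (graft s v t)" "map_sum f g x = map_sum f g y"
  then show "x = y"
    using inj_onD[OF assms(1)] inj_onD[OF assms(2)] by (cases x; cases y) auto
qed

lemma same_tree_graft:
  assumes "same_tree s (map_graph f s)" "inj_on f (verts s)" "same_tree t t'" "v \<in> verts s"
  shows "same_tree (graft s v t) (graft (map_graph f s) (f v) t')"
proof -
  obtain g where g: "inj_on g (verts t)" "t' = map_graph g t"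
    using assms(3) unfolding same_tree_iff_map_graph by blast
  have "rooted_tree (graft s v t)"
    by (rule rooted_tree_graft[OF same_treeD(1)[OF assms(1)] same_treeD(1)[OF assms(3)] assms(4)])
  moreover have "inj_on (map_sum f g) (verts (graft s v t))"
    by (rule inj_on_map_sum_graft[OF assms(2) g(1)])
  ultimately have "same_tree (graft s v t) (map_graph (map_sum f g) (graft s v t))"
    by (rule same_tree_map_graph)
  then show ?thesis
    by (simp only: g(2) map_graph_graft)
qed

lemma same_tree_root_graft:
  assumes "same_tree s s'" "same_tree t t'"
  shows "same_tree (graft s (root s) t) (graft s' (root s') t')"
proof -
  obtain f where f: "inj_on f (verts s)" "s' = map_graph f s"
    using assms(1) unfolding same_tree_iff_map_graph by blast
  with same_tree_graft[of s f t t' "root s"] assms rooted_treeD(2)[OF same_treeD(1)[OF assms(1)]]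
  show ?thesis by simp
qed

section \<open>Isomorphism classes, their size and root degree\<close>

lemma rooted_tree_rep: "rooted_tree (rep_itree i)"
  using Quotient3_rep_reflp[OF Quotient3_itree, of i] by (simp add: same_tree_def)

lemma same_tree_rep_iff: "same_tree (rep_itree i) (rep_itree j) \<longleftrightarrow> i = j"
  by (rule Quotient3_rel_rep[OF Quotient3_itree])

text \<open>The class of a tree on an arbitrary vertex type; the quotient map \<^const>\<open>abs_itree\<close> is only
  available for trees on natural numbers.\<close>

definition tree_class :: "'a rgraph \<Rightarrow> itree" where
  "tree_class t = (THE i. same_tree (rep_itree i) t)"

lemma tree_class_eqI:
  assumes "same_tree (rep_itree i) t" shows "tree_class t = i"
  unfolding tree_class_def
proof (rule the_equality[of "\<lambda>i. same_tree (rep_itree i) t", OF assms])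
  fix j assume "same_tree (rep_itree j) t"
  with assms show "j = i"
    using same_tree_trans same_tree_sym same_tree_rep_iff by blast
qed

lemma same_tree_class:
  assumes t: "rooted_tree t"
  shows "same_tree (rep_itree (tree_class t)) t"
proof -
  obtain f :: "'a \<Rightarrow> nat" where f: "inj_on f (verts t)"
    using finite_imp_inj_to_nat_seg[OF rooted_treeD(1)[OF t]] by blast
  note t' = same_tree_map_graph[OF t f]
  have "same_tree (map_graph f t) (map_graph f t)"
    using same_tree_trans[OF same_tree_sym[OF t'] t'] .
  then have "same_tree (rep_itree (abs_itree (map_graph f t))) (map_graph f t)"
    by (rule Quotient3_rep_abs[OF Quotient3_itree])
  from same_tree_trans[OF this same_tree_sym[OF t']]
  have "same_tree (rep_itree (abs_itree (map_graph f t))) t" .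
  with tree_class_eqI[OF this] show ?thesis by simp
qed

lemma tree_class_eq_iff:
  assumes "rooted_tree s" "rooted_tree t"
  shows "tree_class s = tree_class t \<longleftrightarrow> same_tree s t"
proof
  assume "tree_class s = tree_class t"
  with same_tree_class[OF assms(1)] same_tree_class[OF assms(2)] show "same_tree s t"
    using same_tree_trans[OF same_tree_sym] by metis
next
  assume "same_tree s t"
  from same_tree_trans[OF same_tree_class[OF assms(1)] this] show "tree_class s = tree_class t"
    by (rule tree_class_eqI[symmetric])
qed

lemma tree_class_rep [simp]: "tree_class (rep_itree i) = i"
  by (rule tree_class_eqI) (simp add: same_tree_rep_iff)

definition root_degree :: "'a rgraph \<Rightarrow> nat" where
  "root_degree t = card {c. {root t, c} \<in> edges t}"

lemma root_degree_map_graph: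
  assumes t: "rooted_tree t" and inj: "inj_on f (verts t)"
  shows "root_degree (map_graph f t) = root_degree t"
proof -
  have "{c. {f (root t), c} \<in> (`) f ` edges t} = f ` {c. {root t, c} \<in> edges t}"
  proof (intro equalityI subsetI)
    fix c assume "c \<in> {c. {f (root t), c} \<in> (`) f ` edges t}"
    then obtain g where g: "g \<in> edges t" "{f (root t), c} = f ` g" by auto
    note gV = rooted_treeD(3)[OF t g(1)]
    obtain a b where ab: "f (root t) = f a" "c = f b" "g = {a, b}"
      using g(2) inj_on_subset[OF inj gV] by (rule inj_image_doubletonE)
    with gV rooted_treeD(2)[OF t] inj have "root t = a"
      by (simp add: inj_on_eq_iff)
    with ab g(1) show "c \<in> f ` {c. {root t, c} \<in> edges t}" by simp
  next
    fix c assume "c \<in> f ` {c. {root t, c} \<in> edges t}"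
    then obtain b where b: "c = f b" "{root t, b} \<in> edges t" by blast
    from imageI[OF b(2), of "(`) f"] b(1) show "c \<in> {c. {f (root t), c} \<in> (`) f ` edges t}"
      by simp
  qed
  moreover have "inj_on f {c. {root t, c} \<in> edges t}"
    by (rule inj_on_subset[OF inj]) (use rooted_treeD(3)[OF t] in blast)
  ultimately show ?thesis
    by (simp add: root_degree_def card_image)
qed

lemma same_tree_invariants:
  assumes "same_tree s t"
  shows "card (verts s) = card (verts t)" "root_degree s = root_degree t"
proof -
  obtain f where f: "inj_on f (verts s)" "t = map_graph f s"
    using assms unfolding same_tree_iff_map_graph by blast
  show "card (verts s) = card (verts t)"
    using f by (simp add: card_image)
  show "root_degree s = root_degree t"
    unfolding f(2) by (rule root_degree_map_graph[OF same_treeD(1)[OF assms] f(1), symmetric])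
qed

text \<open>Only a graft at the root gives the root a new neighbour.\<close>

lemma root_degree_graft:
  fixes s :: "'a rgraph" and t :: "'b rgraph"
  assumes s: "rooted_tree s"
  shows "root_degree (graft s v t) = (if v = root s then Suc (root_degree s) else root_degree s)"
proof -
  let ?N = "{c. {root s, c} \<in> edges s}"
  have fin: "finite ?N"
    by (rule finite_subset[OF _ rooted_treeD(1)[OF s]]) (use rooted_treeD(3)[OF s] in blast)
  have old: "{Inl (root s), c} \<in> (`) Inl ` edges s \<longleftrightarrow> c \<in> Inl ` ?N" for c :: "'a + 'b"
  proof
    assume "{Inl (root s), c} \<in> (`) Inl ` edges s"
    then obtain g where g: "g \<in> edges s" "{Inl (root s), c} = Inl ` g" by blast
    from g(2) obtain a b where "Inl (root s) = (Inl a :: 'a + 'b)" "c = Inl b" "g = {a, b}"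
      by (rule inj_image_doubletonE) simp
    with g(1) show "c \<in> Inl ` ?N" by simp
  next
    assume "c \<in> Inl ` ?N"
    then obtain b where b: "c = Inl b" "{root s, b} \<in> edges s" by blast
    have "{Inl (root s), c} = Inl ` {root s, b}" using b(1) by simp
    then show "{Inl (root s), c} \<in> (`) Inl ` edges s" using b(2) by (rule image_eqI)
  qed
  have no: "{Inl (root s), c} \<notin> (`) Inr ` edges t" for c :: "'a + 'b"
  proof
    assume "{Inl (root s), c} \<in> (`) Inr ` edges t"
    then obtain g where "{Inl (root s), c} = Inr ` g" by blast
    then show False by (rule image_doubletonE) simp
  qed
  have "{c. {root (graft s v t), c} \<in> edges (graft s v t)}
      = (if v = root s then insert (Inr (root t)) (Inl ` ?N) else Inl ` ?N)"
    by (auto simp: old no doubleton_eq_iff)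
  then show ?thesis
    using fin by (auto simp: root_degree_def card_insert_if card_image)
qed

lemma card_verts_graft:
  assumes "rooted_tree s" "rooted_tree t"
  shows "card (verts (graft s v t)) = card (verts s) + card (verts t)"
  using rooted_treeD(1)[OF assms(1)] rooted_treeD(1)[OF assms(2)]
  by (simp add: graft_def card_Plus)

definition tree_degree :: "itree \<Rightarrow> nat" where
  "tree_degree i = root_degree (rep_itree i)"

definition root_graft :: "itree \<Rightarrow> itree \<Rightarrow> itree" where
  "root_graft u v = tree_class (graft (rep_itree u) (root (rep_itree u)) (rep_itree v))"

definition is_graft :: "itree \<Rightarrow> itree \<Rightarrow> itree \<Rightarrow> bool" where
  "is_graft r u v \<longleftrightarrow> (\<exists>w\<in>verts (rep_itree u). r = tree_class (graft (rep_itree u) w (rep_itree v)))"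

lemma rooted_tree_graft_rep:
  "w \<in> verts (rep_itree u) \<Longrightarrow> rooted_tree (graft (rep_itree u) w (rep_itree v))"
  by (rule rooted_tree_graft[OF rooted_tree_rep rooted_tree_rep])

lemma root_rep: "root (rep_itree u) \<in> verts (rep_itree u)"
  by (rule rooted_treeD(2)[OF rooted_tree_rep])

lemma tree_class_root_graft:
  assumes "rooted_tree s" "rooted_tree t"
  shows "tree_class (graft s (root s) t) = root_graft (tree_class s) (tree_class t)"
  unfolding root_graft_def
proof (subst tree_class_eq_iff)
  show "rooted_tree (graft s (root s) t)"
    by (rule rooted_tree_graft[OF assms rooted_treeD(2)[OF assms(1)]])
  show "same_tree (graft s (root s) t)
    (graft (rep_itree (tree_class s)) (root (rep_itree (tree_class s))) (rep_itree (tree_class t)))"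
    by (intro same_tree_root_graft same_tree_sym[OF same_tree_class] assms)
qed (rule rooted_tree_graft_rep[OF root_rep])

section \<open>Refinement of root graftings\<close>

text \<open>Both sides are one tree \<open>T\<close>, and cutting \<open>T\<close> at an edge determines the two parts up to isomorphism.
  Cut \<open>T = graft u v\<close> at the edge \<open>e\<close> that corresponds to the new edge of the graft of \<open>b\<close> to \<open>w\<close>; the parts
  are \<open>w\<close> and \<open>b\<close>. If \<open>e\<close> is the new edge of the graft of \<open>v\<close> to \<open>u\<close>, the parts are also \<open>u\<close> and \<open>v\<close>.
  Otherwise \<open>e\<close>, which contains the root, is an edge of \<open>u\<close> at the root; cutting \<open>u\<close> there gives \<open>z\<close> and
  a branch. As two graftings at one root commute, the parts of \<open>T\<close> at \<open>e\<close> are the graft of \<open>v\<close> to \<open>z\<close>, and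
  that branch.\<close>

lemma root_graft_refinement:
  assumes "root_graft u v = root_graft w b"
  shows "(u = w \<and> v = b) \<or> (\<exists>z. u = root_graft z b \<and> w = root_graft z v)"
proof -
  let ?U = "rep_itree u" and ?V = "rep_itree v" and ?W = "rep_itree w" and ?B = "rep_itree b"
  let ?T1 = "graft ?U (root ?U) ?V" and ?T2 = "graft ?W (root ?W) ?B"
  let ?n1 = "{Inl (root ?U), Inr (root ?V)}" and ?n2 = "{Inl (root ?W), Inr (root ?B)}"
  note rt = rooted_tree_rep
  have T: "rooted_tree ?T1" "rooted_tree ?T2" by (rule rooted_tree_graft_rep[OF root_rep])+
  have "same_tree ?T2 ?T1"
    using assms tree_class_eq_iff[OF T(2,1)] by (simp add: root_graft_def)
  then obtain f where f: "inj_on f (verts ?T2)" "?T1 = map_graph f ?T2"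
    unfolding same_tree_iff_map_graph by blast
  define e where "e = f ` ?n2"
  have n2: "?n2 \<in> edges ?T2" by simp
  have W: "same_tree ?W (R_part e ?T1)" and B: "same_tree ?B (P_part e ?T1)"
    using same_tree_trans[OF same_tree_parts_graft(1)[OF rt rt root_rep]
        same_tree_parts_map(1)[OF T(2) f(1) n2]]
      same_tree_trans[OF same_tree_parts_graft(2)[OF rt rt root_rep]
        same_tree_parts_map(2)[OF T(2) f(1) n2]]
    unfolding e_def f(2) by blast+
  have "f ` ?n2 \<in> edges (map_graph f ?T2)"
    unfolding map_graph_simps(2) using n2 by (rule imageI)
  then have e1: "e \<in> edges ?T1"
    unfolding e_def f(2) .
  have "f (Inl (root ?W)) = Inl (root ?U)"
    using arg_cong[OF f(2), of root] by simp
  then have e_root: "Inl (root ?U) \<in> e" by (auto simp: e_def)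
  from e1 consider "e = ?n1" | g where "g \<in> edges ?V" "e = Inr ` g" | g where "g \<in> edges ?U" "e = Inl ` g"
    by auto
  then show ?thesis
  proof cases
    case 1
    have "same_tree ?W ?U" "same_tree ?B ?V"
      using same_tree_trans[OF W[unfolded 1] same_tree_sym[OF same_tree_parts_graft(1)[OF rt rt root_rep]]]
        same_tree_trans[OF B[unfolded 1] same_tree_sym[OF same_tree_parts_graft(2)[OF rt rt root_rep]]] .
    then show ?thesis by (simp add: same_tree_rep_iff)
  next
    case 2
    with e_root show ?thesis by auto
  next
    case 3
    let ?Z = "R_part g ?U" and ?C = "P_part g ?U"
    obtain x y where g: "g = {x, y}" "x \<in> root_part ?U g" "y \<in> verts ?U" "y \<notin> root_part ?U g"
      by (rule root_part_endpoints[OF rt 3(1)])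
    have "root ?U \<in> g" using e_root 3(2) by auto
    then have x: "x = root ?U"
      using g root_in_root_part[OF rt, of u g] by auto
    have Z: "rooted_tree ?Z" and C: "rooted_tree ?C"
      by (rule rooted_tree_R_part[OF rt] rooted_tree_P_part[OF rt 3(1)])+
    have rootZ: "root ?Z = root ?U"
      by (simp add: R_part_eq[OF rt])
    let ?h = "case_sum id id"
    let ?X = "graft ?Z (root ?Z) ?C"
    have X: "rooted_tree ?X" by (rule rooted_tree_graft[OF Z C rooted_treeD(2)[OF Z]])
    note parts = graft_parts[OF rt g(1) 3(1) g(2,4), unfolded x, folded rootZ]
    have u: "u = root_graft (tree_class ?Z) (tree_class ?C)"
      using tree_class_root_graft[OF Z C] tree_class_eq_iff[OF X rt, of u]
        same_tree_map_graph[OF X parts(2)] unfolding parts(1) by simp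
    \<comment> \<open>The tree \<open>T\<close> as \<open>(z \<triangleleft> c) \<triangleleft> v\<close>, with \<open>e\<close> as the edge inserted first.\<close>
    let ?Y = "graft ?X (root ?X) ?V" and ?H = "map_sum ?h id"
    let ?nX = "{Inl (root ?Z), Inr (root ?C)}"
    have Y: "rooted_tree ?Y" by (rule rooted_tree_graft[OF X rt rooted_treeD(2)[OF X]])
    have V: "map_graph id ?V = ?V" by (simp add: map_graph_def)
    have "?h (root ?X) = root ?U" using rootZ by simp
    then have HY: "map_graph ?H ?Y = ?T1"
      by (simp only: map_graph_graft parts(1) V)
    have H: "inj_on ?H (verts ?Y)"
      by (rule inj_on_map_sum_graft[OF parts(2) inj_on_id])
    have "?H ` (Inl ` ?nX) = Inl ` (?h ` ?nX)"
      by (simp only: image_image map_sum.simps)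
    then have He: "?H ` (Inl ` ?nX) = e"
      by (simp only: parts(3) 3(2))
    have eY: "Inl ` ?nX \<in> edges ?Y" by simp
    \<comment> \<open>The same tree as \<open>(z \<triangleleft> v) \<triangleleft> c\<close>, with \<open>e\<close> as the edge inserted last.\<close>
    let ?Q = "graft ?Z (root ?Z) ?V"
    let ?Y' = "graft ?Q (root ?Q) ?C"
    let ?\<sigma> = "case_sum (case_sum (Inl \<circ> Inl) Inr) (Inl \<circ> Inr)"
    have \<sigma>: "map_graph ?\<sigma> ?Y = ?Y'"
      by (simp add: map_graph_def graft_def Plus_def image_Un image_image Un_ac insert_commute)
    have \<sigma>inj: "inj_on ?\<sigma> (verts ?Y)" by (auto simp: inj_on_def)
    have \<sigma>e: "?\<sigma> ` (Inl ` ?nX) = {Inl (root ?Q), Inr (root ?C)}" by simp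
    have Q: "rooted_tree ?Q" by (rule rooted_tree_graft[OF Z rt rooted_treeD(2)[OF Z]])
    note via_H = same_tree_parts_map[OF Y H eY, unfolded HY He]
    note via_\<sigma> = same_tree_parts_map[OF Y \<sigma>inj eY, unfolded \<sigma> \<sigma>e]
    note at_Y' = same_tree_parts_graft[OF Q C rooted_treeD(2)[OF Q]]
    have "same_tree ?W ?Q"
      using same_tree_trans[OF same_tree_trans[OF W same_tree_sym[OF via_H(1)]]
          same_tree_trans[OF via_\<sigma>(1) same_tree_sym[OF at_Y'(1)]]] .
    moreover have "same_tree ?B ?C"
      using same_tree_trans[OF same_tree_trans[OF B same_tree_sym[OF via_H(2)]]
          same_tree_trans[OF via_\<sigma>(2) same_tree_sym[OF at_Y'(2)]]] .
    ultimately have "w = tree_class ?Q" "b = tree_class ?C"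
      using tree_class_eq_iff[OF rt Q] tree_class_eq_iff[OF rt C] by simp_all
    then have "w = root_graft (tree_class ?Z) v" "b = tree_class ?C"
      using tree_class_root_graft[OF Z rt] by simp_all
    with u show ?thesis by blast
  qed
qed

lemma tree_size_class: "rooted_tree t \<Longrightarrow> tree_size (tree_class t) = card (verts t)"
  using same_tree_invariants(1)[OF same_tree_class] by (simp add: tree_size_def)

lemma tree_degree_class: "rooted_tree t \<Longrightarrow> tree_degree (tree_class t) = root_degree t"
  using same_tree_invariants(2)[OF same_tree_class] by (simp add: tree_degree_def)

lemma tree_degree_graft:
  assumes "w \<in> verts (rep_itree u)"
  shows "tree_degree (tree_class (graft (rep_itree u) w (rep_itree v)))
    = (if w = root (rep_itree u) then Suc (tree_degree u) else tree_degree u)"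
  unfolding tree_degree_class[OF rooted_tree_graft_rep[OF assms]] root_degree_graft[OF rooted_tree_rep]
  unfolding tree_degree_def ..

section \<open>The structure constants\<close>

text \<open>Any counting function with the support of \<^const>\<open>is_graft\<close> will do. Its support is finite because a
  graft of \<open>v\<close> to \<open>u\<close> is determined by a vertex of \<open>u\<close>.\<close>

lemma root_grafting_itree:
  assumes N: "\<And>r u v. N r u v \<noteq> 0 \<longleftrightarrow> is_graft r u v"
  shows "root_grafting root_graft tree_size tree_degree N"
proof
  show "(u = w \<and> v = b) \<or> (\<exists>z. u = root_graft z b \<and> w = root_graft z v)"
    if "root_graft u v = root_graft w b" for u v w b
    using that by (rule root_graft_refinement)
  show "tree_size (root_graft u v) = tree_size u + tree_size v" for u v
    unfolding root_graft_def tree_size_class[OF rooted_tree_graft_rep[OF root_rep]]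
    by (simp only: tree_size_def card_verts_graft[OF rooted_tree_rep rooted_tree_rep])
  show "0 < tree_size u" for u
    unfolding tree_size_def card_gt_0_iff using rooted_treeD(1)[OF rooted_tree_rep] root_rep by blast
  show "tree_degree (root_graft u v) = Suc (tree_degree u)" for u v
    unfolding root_graft_def by (simp add: tree_degree_graft[OF root_rep])
  show "N (root_graft u v) u v \<noteq> 0" for u v
    unfolding N is_graft_def root_graft_def using root_rep by blast
  show "tree_degree r \<le> Suc (tree_degree u)" if "N r u v \<noteq> 0" for r u v
    using that by (auto simp: N is_graft_def tree_degree_graft simp del: neq0_conv)
  show "r = root_graft u v" if "N r u v \<noteq> 0" "tree_degree r = Suc (tree_degree u)" for r u v
    using that by (auto simp: N is_graft_def root_graft_def tree_degree_graft simp del: neq0_conv split: if_splits)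
  show "finite {r. N r u v \<noteq> 0}" for u v
  proof (rule finite_surj[OF rooted_treeD(1)[OF rooted_tree_rep[of u]]])
    show "{r. N r u v \<noteq> 0} \<subseteq> (\<lambda>w. tree_class (graft (rep_itree u) w (rep_itree v))) ` verts (rep_itree u)"
      unfolding N is_graft_def by blast
  qed
qed

lemma beta_nonzero_iff: "beta r v u \<noteq> 0 \<longleftrightarrow> is_graft r u v"
proof -
  have "rep_itree r \<simeq> graft (rep_itree u) w (rep_itree v) \<longleftrightarrow> r = tree_class (graft (rep_itree u) w (rep_itree v))"
    if "w \<in> verts (rep_itree u)" for w
    using tree_class_eq_iff[OF rooted_tree_rep rooted_tree_graft_rep[OF that], of r v]
      rooted_tree_rep rooted_tree_graft_rep[OF that] by (simp add: same_tree_def)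
  then show ?thesis
    unfolding beta_def is_graft_def using rooted_treeD(1)[OF rooted_tree_rep[of u]]
    by (auto simp: card_eq_0_iff)
qed

text \<open>The numbers \<^term>\<open>alpha v r u\<close> and \<^term>\<open>beta r v u\<close> differ by a factor made of the orders of
  automorphism groups, but an edge of \<open>r\<close> with parts \<open>u\<close> and \<open>v\<close> exists if and only if \<open>r\<close> is a graft of \<open>v\<close> to \<open>u\<close>.\<close>

lemma alpha_nonzero_iff: "alpha v r u \<noteq> 0 \<longleftrightarrow> is_graft r u v"
proof -
  let ?T = "rep_itree r" and ?U = "rep_itree u" and ?V = "rep_itree v"
  note rt = rooted_tree_rep
  have "alpha v r u \<noteq> 0 \<longleftrightarrow> (\<exists>e\<in>edges ?T. R_part e ?T \<simeq> ?U \<and> P_part e ?T \<simeq> ?V)"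
    unfolding alpha_def using finite_edges[OF rt[of r]] by (auto simp: card_eq_0_iff)
  also have "\<dots> \<longleftrightarrow> (\<exists>e\<in>edges ?T. same_tree (R_part e ?T) ?U \<and> same_tree (P_part e ?T) ?V)"
    using rooted_tree_R_part[OF rt] rooted_tree_P_part[OF rt] rt by (auto simp: same_tree_def)
  also have "\<dots> \<longleftrightarrow> is_graft r u v"
  proof
    assume "\<exists>e\<in>edges ?T. same_tree (R_part e ?T) ?U \<and> same_tree (P_part e ?T) ?V"
    then obtain e where e: "e \<in> edges ?T" "same_tree (R_part e ?T) ?U" "same_tree (P_part e ?T) ?V"
      by blast
    obtain x y where xy: "e = {x, y}" "x \<in> root_part ?T e" "y \<in> verts ?T" "y \<notin> root_part ?T e"
      by (rule root_part_endpoints[OF rt e(1)])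
    note parts = graft_parts[OF rt xy(1) e(1) xy(2,4)]
    have x: "x \<in> verts (R_part e ?T)" using xy(2) by (simp add: R_part_eq[OF rt])
    obtain f where f: "inj_on f (verts (R_part e ?T))" "?U = map_graph f (R_part e ?T)"
      using e(2) unfolding same_tree_iff_map_graph by blast
    have "same_tree (graft (R_part e ?T) x (P_part e ?T)) (graft ?U (f x) ?V)"
      using same_tree_graft[OF _ f(1) e(3) x] e(2) unfolding f(2) by blast
    moreover have "same_tree (graft (R_part e ?T) x (P_part e ?T)) ?T"
      using same_tree_map_graph[OF rooted_tree_graft[OF same_treeD(1)[OF e(2)] same_treeD(1)[OF e(3)] x] parts(2)]
      unfolding parts(1) .
    ultimately have "same_tree ?T (graft ?U (f x) ?V)"
      using same_tree_sym same_tree_trans by blast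
    then have "r = tree_class (graft ?U (f x) ?V)"
      by (rule tree_class_eqI[symmetric])
    moreover have "f x \<in> verts ?U" using x unfolding f(2) by simp
    ultimately show "is_graft r u v" unfolding is_graft_def by blast
  next
    assume "is_graft r u v"
    then obtain w where w: "w \<in> verts ?U" "r = tree_class (graft ?U w ?V)"
      unfolding is_graft_def by blast
    let ?G = "graft ?U w ?V" and ?n = "{Inl w, Inr (root ?V)}"
    have G: "rooted_tree ?G" by (rule rooted_tree_graft_rep[OF w(1)])
    have "same_tree ?G ?T"
      using same_tree_sym[OF same_tree_class[OF G]] w(2) by simp
    then obtain f where f: "inj_on f (verts ?G)" "?T = map_graph f ?G"
      unfolding same_tree_iff_map_graph by blast
    have n: "?n \<in> edges ?G" by simp
    have "f ` ?n \<in> edges (map_graph f ?G)"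
      unfolding map_graph_simps(2) using n by (rule imageI)
    moreover have "same_tree (R_part (f ` ?n) (map_graph f ?G)) ?U"
      using same_tree_parts_map(1)[OF G f(1) n] same_tree_parts_graft(1)[OF rt rt w(1)]
        same_tree_sym same_tree_trans by blast
    moreover have "same_tree (P_part (f ` ?n) (map_graph f ?G)) ?V"
      using same_tree_parts_map(2)[OF G f(1) n] same_tree_parts_graft(2)[OF rt rt w(1)]
        same_tree_sym same_tree_trans by blast
    ultimately show "\<exists>e\<in>edges ?T. same_tree (R_part e ?T) ?U \<and> same_tree (P_part e ?T) ?V"
      unfolding f(2) by blast
  qed
  finally show ?thesis .
qed

theorem proposition4p3:
  fixes scale :: "complex \<Rightarrow> 'g::ab_group_add \<Rightarrow> 'g"
    and bracket :: "'g \<Rightarrow> 'g \<Rightarrow> 'g"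
    and d :: 'g and Dp Dm :: "itree \<Rightarrow> 'g"
  assumes "insertion_elimination_algebra scale bracket d Dp Dm"
  shows "lie_algebra.completely_self_centralizing scale bracket
           (insertion_elimination_algebra.g_plus scale Dp)
       \<and> lie_algebra.completely_self_centralizing scale bracket
           (insertion_elimination_algebra.g_minus scale Dm)"
proof -
  interpret insertion_elimination_algebra scale bracket d Dp Dm by fact
  have lie: "lie_algebra scale bracket" by unfold_locales
  interpret plus: root_grafting root_graft tree_size tree_degree "\<lambda>r u v. beta r v u"
    by (rule root_grafting_itree) (rule beta_nonzero_iff)
  interpret minus: root_grafting root_graft tree_size tree_degree "\<lambda>r u v. alpha v r u"
    by (rule root_grafting_itree) (rule alpha_nonzero_iff)
  have indep: "independent (range Dp)" "independent (range Dm)"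
    by (rule independent_mono[OF basis_independent]; blast)+
  have "completely_self_centralizing (span (range Dp))"
    by (rule plus.completely_self_centralizing_span[OF lie basis_distinct(1) indep(1), of "-1"])
      (simp_all add: bracket_Dp_Dp)
  moreover have "completely_self_centralizing (span (range Dm))"
    by (rule minus.completely_self_centralizing_span[OF lie basis_distinct(2) indep(2), of 1])
      (simp_all add: bracket_Dm_Dm)
  ultimately show ?thesis
    by (simp add: g_plus_def g_minus_def)
qed

end
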